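(* Let $n$ be a positive integer. The $n$th Burnside Kei $BQ_n(L)$ of a link $L$ is preserved (up to Kei isomorphism) by $n$-moves on $L$ and, more generally, by rational $\frac{n}{q}$-moves on $L$ for every integer $q$ coprime to $n$.
   Context: A Kei (involutive quandle) is a set $Q$ with a binary operation $*$ such that for all $a,b,c\in Q$: $a*a=a$; $(a*b)*b=a$; $(a*b)*c=(a*c)*(b*c)$. Products without parentheses are left-normed: $a*b*c*d=((a*b)*c)*d$. For an unoriented link $L\subset S^3$ with diagram $D$, the Kei $\bar Q(L)$ is the Kei generated by the arcs of $D$ (a crossingless closed component counts as one arc), with one relation $c=a*b$ for each crossing, where $b$ is the overcrossing arc and $a,c$ are the two undercrossing arcs. It is a link invariant up to isomorphism. For elements $a,b$ of a Kei, $r_n(a,b)$ denotes the relation $a=w_n(a,b)$, where $w_n(a,b)$ is the left-normed alternating product with exactly $n$ letters ending in $b$: $w_n=b*a*b*\cdots*a*b$ if $n$ is odd and $w_n=a*b*\cdots*a*b$ if $n$ is even (e.g. $r_5(a,b)$ is $a=b*a*b*a*b$). Equivalently, under the isomorphism $\phi$ from the free Kei on $a,b$ to $\mathbb Z$ with $i*j=2j-i$, $\phi(a)=0$, $\phi(b)=1$, the relation is $\phi^{-1}(0)=\phi^{-1}(n)$. The $n$th Burnside Kei of $L$ is $BQ_n(L)=\bar Q(L)/(r_n(u,w))$, the quotient of $\bar Q(L)$ by all relations $r_n(u,w)$ for all elements $u,w$. For 2-tangles with endpoints NW, NE, SW, SE: $[0]$ is the tangle of two horizontal arcs (NW–NE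 and SW–SE); $[k]$ is $[0]$ with $k$ signed half-twists added by twisting the two right-hand endpoints; $T_1+T_2$ is side-by-side sum; $1/T$ is $T$ rotated by $90^\circ$ and then reflected by switching all crossings (so $1/[1]=[1]$). The rational tangle $n/q$ is the one built by these operations from a continued fraction $n/q=a_1+\frac{1}{a_2+\frac{1}{\cdots+\frac1{a_k}}}$, namely $[a_1]+1/([a_2]+1/(\cdots+1/[a_k]))$ (well defined up to isotopy fixed on the boundary, by Conway). A rational $\frac nq$-move replaces, in some ball meeting the link in the tangle $[0]$, the tangle $[0]$ by the rational tangle $n/q$ (or the inverse replacement). An $n$-move is the rational $\frac n1$-move, i.e. it replaces two parallel strands by $n$ half-twists. *)

theory Defs
  imports Complex_Main
begin

section \<open>Keis\<close>

record 'a binary_structure =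
  carrier :: "'a set"
  star :: "'a \<Rightarrow> 'a \<Rightarrow> 'a"  (infixl "\<star>\<index>" 70)

definition kei :: "('a, 'm) binary_structure_scheme \<Rightarrow> bool" where
  "kei Q \<longleftrightarrow>
    (\<forall>a\<in>carrier Q. \<forall>b\<in>carrier Q. a \<star>\<^bsub>Q\<^esub> b \<in> carrier Q) \<and>
    (\<forall>a\<in>carrier Q. a \<star>\<^bsub>Q\<^esub> a = a) \<and>
    (\<forall>a\<in>carrier Q. \<forall>b\<in>carrier Q. (a \<star>\<^bsub>Q\<^esub> b) \<star>\<^bsub>Q\<^esub> b = a) \<and>
    (\<forall>a\<in>carrier Q. \<forall>b\<in>carrier Q. \<forall>c\<in>carrier Q.
       (a \<star>\<^bsub>Q\<^esub> b) \<star>\<^bsub>Q\<^esub> c = (a \<star>\<^bsub>Q\<^esub> c) \<star>\<^bsub>Q\<^esub> (b \<star>\<^bsub>Q\<^esub> c))"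

definition kei_isomorphic ::
    "('a, 'm) binary_structure_scheme \<Rightarrow> ('b, 'k) binary_structure_scheme \<Rightarrow> bool"
    (infix "\<cong>\<^sub>K" 50) where
  "P \<cong>\<^sub>K Q \<longleftrightarrow> (\<exists>f. bij_betw f (carrier P) (carrier Q) \<and>
    (\<forall>a\<in>carrier P. \<forall>b\<in>carrier P. f (a \<star>\<^bsub>P\<^esub> b) = f a \<star>\<^bsub>Q\<^esub> f b))"

lemma kei_closed:
  "kei Q \<Longrightarrow> a \<in> carrier Q \<Longrightarrow> b \<in> carrier Q \<Longrightarrow> a \<star>\<^bsub>Q\<^esub> b \<in> carrier Q"
  by (simp add: kei_def)

subsection \<open>Quotients\<close>

definition congruence :: "('a, 'm) binary_structure_scheme \<Rightarrow> ('a \<times> 'a) set \<Rightarrow> bool" where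
  "congruence Q E \<longleftrightarrow> equiv (carrier Q) E \<and>
    (\<forall>(a, a')\<in>E. \<forall>(b, b')\<in>E. (a \<star>\<^bsub>Q\<^esub> b, a' \<star>\<^bsub>Q\<^esub> b') \<in> E)"

definition congruence_generated ::
    "('a, 'm) binary_structure_scheme \<Rightarrow> ('a \<times> 'a) set \<Rightarrow> ('a \<times> 'a) set" where
  "congruence_generated Q R = \<Inter> {E. congruence Q E \<and> R \<subseteq> E}"

definition quotient_by ::
    "('a, 'm) binary_structure_scheme \<Rightarrow> ('a \<times> 'a) set \<Rightarrow> 'a set binary_structure" where
  "quotient_by Q R =
    \<lparr>carrier = carrier Q // congruence_generated Q R,
     star = (\<lambda>A B. \<Union>a\<in>A. \<Union>b\<in>B. congruence_generated Q R `` {a \<star>\<^bsub>Q\<^esub> b})\<rparr>"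

lemma congruence_generated:
  assumes closed: "\<And>a b. a \<in> carrier Q \<Longrightarrow> b \<in> carrier Q \<Longrightarrow> a \<star>\<^bsub>Q\<^esub> b \<in> carrier Q"
    and R: "R \<subseteq> carrier Q \<times> carrier Q"
  shows "congruence Q (congruence_generated Q R)" and "R \<subseteq> congruence_generated Q R"
proof -
  let ?F = "{E. congruence Q E \<and> R \<subseteq> E}"
  have full: "carrier Q \<times> carrier Q \<in> ?F"
    using assms by (auto simp: congruence_def equiv_def refl_on_def sym_def trans_def)
  have eq: "equiv (carrier Q) E" if "E \<in> ?F" for E
    using that by (auto simp: congruence_def)
  have "equiv (carrier Q) (\<Inter>?F)"
  proof (rule equivI)
    show "\<Inter>?F \<subseteq> carrier Q \<times> carrier Q" using full by blast
    show "refl_on (carrier Q) (\<Inter>?F)"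
      using eq by (auto simp: refl_on_def equiv_def)
    have "sym E" "trans E" if "E \<in> ?F" for E
      using eq[OF that] by (auto simp: equiv_def)
    then show "sym (\<Inter>?F)" "trans (\<Inter>?F)"
      by (blast intro: symI transI dest: symD transD)+
  qed
  moreover have "(a \<star>\<^bsub>Q\<^esub> b, a' \<star>\<^bsub>Q\<^esub> b') \<in> \<Inter>?F"
    if ab: "(a, a') \<in> \<Inter>?F" "(b, b') \<in> \<Inter>?F" for a a' b b'
  proof
    fix E assume E: "E \<in> ?F"
    with ab have "(a, a') \<in> E" "(b, b') \<in> E" by blast+
    with E show "(a \<star>\<^bsub>Q\<^esub> b, a' \<star>\<^bsub>Q\<^esub> b') \<in> E" unfolding congruence_def by blast
  qed
  ultimately show "congruence Q (congruence_generated Q R)"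
    unfolding congruence_def congruence_generated_def by blast
  show "R \<subseteq> congruence_generated Q R" by (auto simp: congruence_generated_def)
qed

lemma star_quotient_by:
  assumes "congruence Q (congruence_generated Q R)" "a \<in> carrier Q" "b \<in> carrier Q"
  shows "congruence_generated Q R `` {a} \<star>\<^bsub>quotient_by Q R\<^esub> congruence_generated Q R `` {b}
    = congruence_generated Q R `` {a \<star>\<^bsub>Q\<^esub> b}"
proof -
  let ?E = "congruence_generated Q R"
  have E: "equiv (carrier Q) ?E" using assms by (simp add: congruence_def)
  have "?E `` {a' \<star>\<^bsub>Q\<^esub> b'} = ?E `` {a \<star>\<^bsub>Q\<^esub> b}"
    if "a' \<in> ?E `` {a}" "b' \<in> ?E `` {b}" for a' b'
  proof -
    have "(a, a') \<in> ?E" "(b, b') \<in> ?E" using that by blast+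
    then have "(a \<star>\<^bsub>Q\<^esub> b, a' \<star>\<^bsub>Q\<^esub> b') \<in> ?E"
      using assms(1) unfolding congruence_def by blast
    then show ?thesis using equiv_class_eq[OF E] by blast
  qed
  moreover have "?E `` {a} \<noteq> {}" "?E `` {b} \<noteq> {}"
    using equiv_class_self[OF E] assms(2,3) by blast+
  ultimately show ?thesis by (simp add: quotient_by_def)
qed

lemma kei_quotient_by_laws:
  assumes closed: "\<And>a b. a \<in> carrier Q \<Longrightarrow> b \<in> carrier Q \<Longrightarrow> a \<star>\<^bsub>Q\<^esub> b \<in> carrier Q"
    and R: "R \<subseteq> carrier Q \<times> carrier Q"
    and idem: "\<And>a. a \<in> carrier Q \<Longrightarrow> (a \<star>\<^bsub>Q\<^esub> a, a) \<in> congruence_generated Q R"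
    and invol: "\<And>a b. a \<in> carrier Q \<Longrightarrow> b \<in> carrier Q \<Longrightarrow>
      ((a \<star>\<^bsub>Q\<^esub> b) \<star>\<^bsub>Q\<^esub> b, a) \<in> congruence_generated Q R"
    and distrib: "\<And>a b c. a \<in> carrier Q \<Longrightarrow> b \<in> carrier Q \<Longrightarrow> c \<in> carrier Q \<Longrightarrow>
      ((a \<star>\<^bsub>Q\<^esub> b) \<star>\<^bsub>Q\<^esub> c, (a \<star>\<^bsub>Q\<^esub> c) \<star>\<^bsub>Q\<^esub> (b \<star>\<^bsub>Q\<^esub> c)) \<in> congruence_generated Q R"
  shows "kei (quotient_by Q R)"
proof -
  let ?E = "congruence_generated Q R"
  have C: "congruence Q ?E" using congruence_generated(1)[OF closed R] .
  then have E: "equiv (carrier Q) ?E" by (simp add: congruence_def)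
  have carr: "carrier (quotient_by Q R) = (\<lambda>a. ?E `` {a}) ` carrier Q"
    by (auto simp: quotient_by_def quotient_def)
  note cls = equiv_class_eq[OF E]
  note star = star_quotient_by[OF C]
  show ?thesis
    unfolding kei_def carr
  proof (intro conjI ballI; elim imageE; hypsubst)
    fix a b assume ab: "a \<in> carrier Q" "b \<in> carrier Q"
    then show "?E `` {a} \<star>\<^bsub>quotient_by Q R\<^esub> ?E `` {b} \<in> (\<lambda>a. ?E `` {a}) ` carrier Q"
      by (simp add: star closed)
    show "(?E `` {a} \<star>\<^bsub>quotient_by Q R\<^esub> ?E `` {b}) \<star>\<^bsub>quotient_by Q R\<^esub> ?E `` {b} = ?E `` {a}"
      using cls[OF invol[OF ab]] by (simp add: star closed ab)
  next
    fix a assume a: "a \<in> carrier Q"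
    then show "?E `` {a} \<star>\<^bsub>quotient_by Q R\<^esub> ?E `` {a} = ?E `` {a}"
      using cls[OF idem[OF a]] by (simp add: star)
  next
    fix a b c assume abc: "a \<in> carrier Q" "b \<in> carrier Q" "c \<in> carrier Q"
    then show "(?E `` {a} \<star>\<^bsub>quotient_by Q R\<^esub> ?E `` {b}) \<star>\<^bsub>quotient_by Q R\<^esub> ?E `` {c} =
      (?E `` {a} \<star>\<^bsub>quotient_by Q R\<^esub> ?E `` {c}) \<star>\<^bsub>quotient_by Q R\<^esub>
      (?E `` {b} \<star>\<^bsub>quotient_by Q R\<^esub> ?E `` {c})"
      using cls[OF distrib[OF abc]] by (simp add: star closed)
  qed
qed

lemma kei_quotient_by:
  assumes "kei Q" "R \<subseteq> carrier Q \<times> carrier Q"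
  shows "kei (quotient_by Q R)"
proof -
  have closed: "\<And>a b. a \<in> carrier Q \<Longrightarrow> b \<in> carrier Q \<Longrightarrow> a \<star>\<^bsub>Q\<^esub> b \<in> carrier Q"
    using assms by (simp add: kei_def)
  have refl: "(a, b) \<in> congruence_generated Q R" if "a = b" "b \<in> carrier Q" for a b
    using congruence_generated(1)[OF closed assms(2)] that
    by (auto simp: congruence_def equiv_def refl_on_def)
  note laws = assms(1)[unfolded kei_def]
  show ?thesis
  proof (rule kei_quotient_by_laws[OF closed assms(2)])
    fix a assume "a \<in> carrier Q"
    show "(a \<star>\<^bsub>Q\<^esub> a, a) \<in> congruence_generated Q R"
      by (rule refl) (use laws \<open>a \<in> carrier Q\<close> in blast)+
  next
    fix a b assume "a \<in> carrier Q" "b \<in> carrier Q"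
    show "((a \<star>\<^bsub>Q\<^esub> b) \<star>\<^bsub>Q\<^esub> b, a) \<in> congruence_generated Q R"
      by (rule refl) (use laws \<open>a \<in> carrier Q\<close> \<open>b \<in> carrier Q\<close> in blast)+
  next
    fix a b c assume "a \<in> carrier Q" "b \<in> carrier Q" "c \<in> carrier Q"
    show "((a \<star>\<^bsub>Q\<^esub> b) \<star>\<^bsub>Q\<^esub> c, (a \<star>\<^bsub>Q\<^esub> c) \<star>\<^bsub>Q\<^esub> (b \<star>\<^bsub>Q\<^esub> c)) \<in> congruence_generated Q R"
      by (rule refl) (use laws \<open>a \<in> carrier Q\<close> \<open>b \<in> carrier Q\<close> \<open>c \<in> carrier Q\<close> in blast)+
  qed
qed

subsection \<open>Free Keis\<close>

datatype (letters: 'g) kei_term = Letter 'g | Star "'g kei_term" "'g kei_term"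

definition term_algebra :: "'g set \<Rightarrow> 'g kei_term binary_structure" where
  "term_algebra X = \<lparr>carrier = {t. letters t \<subseteq> X}, star = Star\<rparr>"

definition kei_laws :: "'g set \<Rightarrow> ('g kei_term \<times> 'g kei_term) set" where
  "kei_laws X =
    {(Star a a, a) | a. letters a \<subseteq> X} \<union>
    {(Star (Star a b) b, a) | a b. letters a \<subseteq> X \<and> letters b \<subseteq> X} \<union>
    {(Star (Star a b) c, Star (Star a c) (Star b c)) | a b c.
       letters a \<subseteq> X \<and> letters b \<subseteq> X \<and> letters c \<subseteq> X}"

definition free_kei :: "'g set \<Rightarrow> 'g kei_term set binary_structure" where
  "free_kei X = quotient_by (term_algebra X) (kei_laws X)"

definition free_generator :: "'g set \<Rightarrow> 'g \<Rightarrow> 'g kei_term set" where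
  "free_generator X x = congruence_generated (term_algebra X) (kei_laws X) `` {Letter x}"

lemma kei_free_kei: "kei (free_kei X)"
proof -
  let ?T = "term_algebra X"
  have closed: "\<And>a b. a \<in> carrier ?T \<Longrightarrow> b \<in> carrier ?T \<Longrightarrow> a \<star>\<^bsub>?T\<^esub> b \<in> carrier ?T"
    by (simp add: term_algebra_def)
  have R: "kei_laws X \<subseteq> carrier ?T \<times> carrier ?T"
    by (auto simp: term_algebra_def kei_laws_def)
  note gen = congruence_generated(2)[OF closed R]
  show ?thesis
    unfolding free_kei_def
    by (rule kei_quotient_by_laws[OF closed R]; (assumption | rule subsetD[OF gen]))
      (auto simp: term_algebra_def kei_laws_def)
qed

lemma free_generator_in_carrier:
  "x \<in> X \<Longrightarrow> free_generator X x \<in> carrier (free_kei X)"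
  by (auto simp: free_kei_def free_generator_def quotient_by_def term_algebra_def intro!: quotientI)

section \<open>Link diagrams\<close>

text \<open>
  Tangle and link diagrams are given in Morse position with respect to the horizontal
  coordinate: scanning from left to right, a diagram is a sequence of elementary slices.  The
  strands between two slices are numbered \<open>0, 1, 2, \<dots>\<close> from top to bottom.

  \<^item> \<open>Cup i\<close> is a left turning point: it creates two new adjacent strands \<open>i\<close> and \<open>i + 1\<close>.
  \<^item> \<open>Cap i\<close> is a right turning point: it joins the adjacent strands \<open>i\<close> and \<open>i + 1\<close>.
  \<^item> \<open>Cross s i\<close> is a crossing of the strands \<open>i\<close> and \<open>i + 1\<close>.  The overcrossing strand is the
    one that goes down (from position \<open>i\<close> to \<open>i + 1\<close>) if \<open>s\<close> is true, and the one that goes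
    up if \<open>s\<close> is false.

  Every link diagram in the plane is planar isotopic to one of this form.
\<close>

datatype slice = Cup nat | Cap nat | Cross bool nat

type_synonym diagram = "slice list"

fun slice_width :: "slice \<Rightarrow> nat \<Rightarrow> nat" where
  "slice_width (Cup i) m = m + 2"
| "slice_width (Cap i) m = m - 2"
| "slice_width (Cross s i) m = m"

fun slice_fits :: "slice \<Rightarrow> nat \<Rightarrow> bool" where
  "slice_fits (Cup i) m \<longleftrightarrow> i \<le> m"
| "slice_fits (Cap i) m \<longleftrightarrow> i + 2 \<le> m"
| "slice_fits (Cross s i) m \<longleftrightarrow> i + 2 \<le> m"

text \<open>\<open>tangle m T n\<close>: the word \<open>T\<close> is a diagram with \<open>m\<close> left and \<open>n\<close> right endpoints.\<close>

fun tangle :: "nat \<Rightarrow> diagram \<Rightarrow> nat \<Rightarrow> bool" where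
  "tangle m [] n \<longleftrightarrow> m = n"
| "tangle m (x # T) n \<longleftrightarrow> slice_fits x m \<and> tangle (slice_width x m) T n"

definition link_diagram :: "diagram \<Rightarrow> bool" where
  "link_diagram D \<longleftrightarrow> tangle 0 D 0"

subsection \<open>Arcs and crossings\<close>

text \<open>
  The point \<open>(k, j)\<close> of a link diagram \<open>D\<close> is strand number \<open>j\<close> just after the first \<open>k\<close>
  slices.
\<close>

definition points :: "diagram \<Rightarrow> (nat \<times> nat) set" where
  "points D = {(k, j). k \<le> length D \<and> j < fold slice_width (take k D) 0}"

text \<open>
  \<open>adjacent D p q\<close>: some slice connects \<open>p\<close> to \<open>q\<close> by a piece of the diagram that does not
  pass under a crossing.
\<close>

inductive adjacent :: "diagram \<Rightarrow> nat \<times> nat \<Rightarrow> nat \<times> nat \<Rightarrow> bool" for D where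
  cup_above: "k < length D \<Longrightarrow> D ! k = Cup i \<Longrightarrow> j < i \<Longrightarrow> adjacent D (k, j) (Suc k, j)"
| cup_below: "k < length D \<Longrightarrow> D ! k = Cup i \<Longrightarrow> i \<le> j \<Longrightarrow> adjacent D (k, j) (Suc k, j + 2)"
| cup_turn: "k < length D \<Longrightarrow> D ! k = Cup i \<Longrightarrow> adjacent D (Suc k, i) (Suc k, i + 1)"
| cap_above: "k < length D \<Longrightarrow> D ! k = Cap i \<Longrightarrow> j < i \<Longrightarrow> adjacent D (k, j) (Suc k, j)"
| cap_below: "k < length D \<Longrightarrow> D ! k = Cap i \<Longrightarrow> i \<le> j \<Longrightarrow> adjacent D (k, j + 2) (Suc k, j)"
| cap_turn: "k < length D \<Longrightarrow> D ! k = Cap i \<Longrightarrow> adjacent D (k, i) (k, i + 1)"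
| cross_away: "k < length D \<Longrightarrow> D ! k = Cross s i \<Longrightarrow> j \<noteq> i \<Longrightarrow> j \<noteq> i + 1 \<Longrightarrow>
    adjacent D (k, j) (Suc k, j)"
| over_down: "k < length D \<Longrightarrow> D ! k = Cross True i \<Longrightarrow> adjacent D (k, i) (Suc k, i + 1)"
| over_up: "k < length D \<Longrightarrow> D ! k = Cross False i \<Longrightarrow> adjacent D (k, i + 1) (Suc k, i)"

definition arc_of :: "diagram \<Rightarrow> nat \<times> nat \<Rightarrow> (nat \<times> nat) set" where
  "arc_of D p = {q. equivclp (adjacent D) p q}"

definition arcs :: "diagram \<Rightarrow> (nat \<times> nat) set set" where
  "arcs D = arc_of D ` points D"

text \<open>
  \<open>crossing D a b c\<close>: \<open>D\<close> has a crossing with overcrossing arc \<open>b\<close> and undercrossing arcs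
  \<open>a\<close> (on its left) and \<open>c\<close> (on its right).  By the second Kei axiom it does not matter
  which of \<open>a\<close> and \<open>c\<close> is which in the relation \<open>c = a * b\<close>.
\<close>

inductive crossing ::
    "diagram \<Rightarrow> (nat \<times> nat) set \<Rightarrow> (nat \<times> nat) set \<Rightarrow> (nat \<times> nat) set \<Rightarrow> bool" for D where
  "k < length D \<Longrightarrow> D ! k = Cross True i \<Longrightarrow>
    crossing D (arc_of D (k, i + 1)) (arc_of D (k, i)) (arc_of D (Suc k, i))"
| "k < length D \<Longrightarrow> D ! k = Cross False i \<Longrightarrow>
    crossing D (arc_of D (k, i)) (arc_of D (k, i + 1)) (arc_of D (Suc k, i + 1))"

lemma tangle_append: "tangle m (S @ T) n \<longleftrightarrow> (\<exists>k. tangle m S k \<and> tangle k T n)"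
  by (induction S arbitrary: m) auto

lemma tangle_width: "tangle m T n \<Longrightarrow> fold slice_width T m = n"
  by (induction T arbitrary: m) auto

lemma slice_fits_nth:
  assumes "tangle 0 D n" "k < length D"
  shows "slice_fits (D ! k) (fold slice_width (take k D) 0)"
proof -
  have "tangle 0 (take k D @ D ! k # drop (Suc k) D) n"
    using assms by (simp add: id_take_nth_drop[symmetric])
  then show ?thesis by (auto simp: tangle_append dest: tangle_width)
qed

lemma crossing_in_arcs:
  assumes "link_diagram D" "crossing D a b c"
  shows "a \<in> arcs D" "b \<in> arcs D" "c \<in> arcs D"
proof -
  have *: "(k, i) \<in> points D \<and> (k, i + 1) \<in> points D \<and> (Suc k, i) \<in> points D \<and> (Suc k, i + 1) \<in> points D"
    if "k < length D" "D ! k = Cross s i" for k s i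
    using slice_fits_nth[of D 0 k] that assms(1)
    by (simp add: points_def link_diagram_def take_Suc_conv_app_nth)
  show "a \<in> arcs D" "b \<in> arcs D" "c \<in> arcs D"
    using assms(2) by (cases; use * in \<open>force simp: arcs_def\<close>)+
qed

section \<open>The Kei and the Burnside Keis of a link\<close>

definition link_kei :: "diagram \<Rightarrow> (nat \<times> nat) set kei_term set set binary_structure" where
  "link_kei D = (let F = free_kei (arcs D); g = free_generator (arcs D)
     in quotient_by F {(g c, g a \<star>\<^bsub>F\<^esub> g b) | a b c. crossing D a b c})"

text \<open>
  The left-normed product \<open>\<dots> * b * a * b\<close> with exactly \<open>n\<close> alternating letters, the last of
  which is \<open>b\<close>; the value for \<open>n = 0\<close> is a convention.
\<close>

fun alternating :: "('a, 'm) binary_structure_scheme \<Rightarrow> nat \<Rightarrow> 'a \<Rightarrow> 'a \<Rightarrow> 'a" where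
  "alternating Q 0 a b = a"
| "alternating Q (Suc 0) a b = b"
| "alternating Q (Suc (Suc n)) a b = alternating Q (Suc n) b a \<star>\<^bsub>Q\<^esub> b"

definition burnside_kei ::
    "nat \<Rightarrow> diagram \<Rightarrow> (nat \<times> nat) set kei_term set set set binary_structure" where
  "burnside_kei n D = (let Q = link_kei D
     in quotient_by Q {(u, alternating Q n u w) | u w. u \<in> carrier Q \<and> w \<in> carrier Q})"

lemma kei_link_kei:
  assumes "link_diagram D"
  shows "kei (link_kei D)"
proof -
  have "free_generator (arcs D) c \<in> carrier (free_kei (arcs D)) \<and>
      free_generator (arcs D) a \<star>\<^bsub>free_kei (arcs D)\<^esub> free_generator (arcs D) b
        \<in> carrier (free_kei (arcs D))" if "crossing D a b c" for a b c
    using crossing_in_arcs[OF assms that] kei_free_kei[of "arcs D"]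
    by (simp add: free_generator_in_carrier kei_closed)
  then show ?thesis
    unfolding link_kei_def Let_def by (intro kei_quotient_by kei_free_kei) blast
qed

lemma alternating_in_carrier:
  assumes "kei Q" "a \<in> carrier Q" "b \<in> carrier Q"
  shows "alternating Q n a b \<in> carrier Q"
  using assms by (induction Q n a b rule: alternating.induct) (auto simp: kei_closed)

lemma kei_burnside_kei: "link_diagram D \<Longrightarrow> kei (burnside_kei n D)"
  unfolding burnside_kei_def Let_def
  by (intro kei_quotient_by kei_link_kei) (auto intro: alternating_in_carrier kei_link_kei)

section \<open>Isotopy\<close>

text \<open>
  The local moves on diagrams in Morse position: those generating planar isotopy (exchange of
  distant slices, straightening of a zigzag, sliding a strand past a turning point) and the
  Reidemeister moves.  By Reidemeister's theorem, in the form given by Freyd--Yetter and Turaev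
  for diagrams in Morse position, two link diagrams represent isotopic links if and only if they
  are related by these moves and their inverses.
\<close>

fun position :: "slice \<Rightarrow> nat" where
  "position (Cup i) = i"
| "position (Cap i) = i"
| "position (Cross s i) = i"

fun shift_slice :: "nat \<Rightarrow> slice \<Rightarrow> slice" where
  "shift_slice d (Cup i) = Cup (i + d)"
| "shift_slice d (Cap i) = Cap (i + d)"
| "shift_slice d (Cross s i) = Cross s (i + d)"

fun slice_in :: "slice \<Rightarrow> nat" where
  "slice_in (Cup i) = 0"
| "slice_in (Cap i) = 2"
| "slice_in (Cross s i) = 2"

fun slice_out :: "slice \<Rightarrow> nat" where
  "slice_out (Cup i) = 2"
| "slice_out (Cap i) = 0"
| "slice_out (Cross s i) = 2"

text \<open>
  In the exchange move the slice \<open>x\<close> lies above \<open>y\<close>, and the position of \<open>y\<close> is given with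
  the strands of \<open>x\<close> left out: it is shifted by the number of right or left endpoints of \<open>x\<close>
  when \<open>y\<close> comes after or before \<open>x\<close>.  In the third Reidemeister move, the
  side condition says that one of the three strands lies over the two others.
\<close>

inductive local_move :: "diagram \<Rightarrow> diagram \<Rightarrow> bool" where
  exchange: "position x \<le> position y \<Longrightarrow>
    local_move [x, shift_slice (slice_out x) y] [shift_slice (slice_in x) y, x]"
| zigzag_up: "local_move [Cup i, Cap (i + 1)] []"
| zigzag_down: "local_move [Cup (i + 1), Cap i] []"
| slide_cap: "local_move [Cross s i, Cap (i + 1)] [Cross (\<not> s) (i + 1), Cap i]"
| slide_cup: "local_move [Cup i, Cross s (i + 1)] [Cup (i + 1), Cross (\<not> s) i]"
| reidemeister1_cap: "local_move [Cross s i, Cap i] [Cap i]"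
| reidemeister1_cup: "local_move [Cup i, Cross s i] [Cup i]"
| reidemeister2: "local_move [Cross s i, Cross (\<not> s) i] []"
| reidemeister3: "t = s \<or> t = u \<Longrightarrow>
    local_move [Cross s i, Cross t (i + 1), Cross u i]
      [Cross u (i + 1), Cross t i, Cross s (i + 1)]"

definition isotopy_step :: "diagram \<Rightarrow> diagram \<Rightarrow> bool" where
  "isotopy_step D D' \<longleftrightarrow> link_diagram D \<and> link_diagram D' \<and>
    (\<exists>A S T B. local_move S T \<and> D = A @ S @ B \<and> D' = A @ T @ B)"

definition isotopic :: "diagram \<Rightarrow> diagram \<Rightarrow> bool" where
  "isotopic = equivclp isotopy_step"

section \<open>Rational tangles and rational moves\<close>

text \<open>
  In a 2-tangle diagram \<open>tangle 2 T 2\<close> the left endpoints \<open>0\<close>, \<open>1\<close> are NW, SW and the right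
  endpoints \<open>0\<close>, \<open>1\<close> are NE, SE.  The tangle \<open>[0]\<close> is the empty word, and the side-by-side
  sum of tangles is concatenation of words.
\<close>

definition shift :: "nat \<Rightarrow> diagram \<Rightarrow> diagram" where
  "shift d T = map (shift_slice d) T"

fun switch_slice :: "slice \<Rightarrow> slice" where
  "switch_slice (Cup i) = Cup i"
| "switch_slice (Cap i) = Cap i"
| "switch_slice (Cross s i) = Cross (\<not> s) i"

definition integer_tangle :: "int \<Rightarrow> diagram" where
  "integer_tangle k = replicate (nat \<bar>k\<bar>) (Cross (k > 0) 0)"

text \<open>
  \<open>1/T\<close>: to rotate \<open>T\<close> counterclockwise by a right angle, its endpoint NE is bent over the
  top to the left and becomes NW, and its endpoint SW is bent below to the right and becomes SE.
\<close>

definition inverse_tangle :: "diagram \<Rightarrow> diagram" where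
  "inverse_tangle T = [Cup 2] @ shift 1 (map switch_slice T) @ [Cap 0]"

text \<open>The tangle \<open>[a\<^sub>1] + 1/([a\<^sub>2] + 1/(\<dots> + 1/[a\<^sub>k]))\<close>, for a nonempty list.\<close>

fun continued_fraction_tangle :: "int list \<Rightarrow> diagram" where
  "continued_fraction_tangle [] = []"
| "continued_fraction_tangle [a] = integer_tangle a"
| "continued_fraction_tangle (a # b # as) =
    integer_tangle a @ inverse_tangle (continued_fraction_tangle (b # as))"

lemma tangle_shift_switch:
  assumes "tangle m T n"
  shows "tangle (Suc (Suc m)) (shift 1 (map switch_slice T)) (Suc (Suc n))"
proof -
  have "slice_fits (shift_slice 1 (switch_slice x)) (Suc (Suc m)) \<and>
      slice_width (shift_slice 1 (switch_slice x)) (Suc (Suc m)) = Suc (Suc (slice_width x m))"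
    if "slice_fits x m" for x m
    using that by (cases x) auto
  with assms show ?thesis
    by (induction T arbitrary: m) (auto simp: shift_def)
qed

lemma tangle_continued_fraction_tangle: "tangle 2 (continued_fraction_tangle as) 2"
proof -
  have int: "tangle 2 (integer_tangle a) 2" for a
  proof -
    have "tangle 2 (replicate k (Cross s 0)) 2" for k s by (induction k) auto
    then show ?thesis by (simp add: integer_tangle_def)
  qed
  have inv: "tangle 2 (inverse_tangle T) 2" if "tangle 2 T 2" for T
    using tangle_shift_switch[OF that] by (auto simp: inverse_tangle_def tangle_append)
  show ?thesis
    by (induction as rule: continued_fraction_tangle.induct)
      (auto simp: tangle_append intro: int inv)
qed

text \<open>
  Continued fractions take values in \<open>\<rat> \<union> {\<infinity>}\<close>, where \<open>None\<close> stands for \<open>\<infinity>\<close> and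
  \<open>1/0 = \<infinity>\<close>, \<open>1/\<infinity> = 0\<close>, \<open>a + \<infinity> = \<infinity>\<close>.
\<close>

definition fraction :: "int \<Rightarrow> int \<Rightarrow> rat option" where
  "fraction p q = (if q = 0 then None else Some (of_int p / of_int q))"

fun reciprocal :: "rat option \<Rightarrow> rat option" where
  "reciprocal None = Some 0"
| "reciprocal (Some x) = (if x = 0 then None else Some (1 / x))"

fun continued_fraction :: "int list \<Rightarrow> rat option" where
  "continued_fraction [] = None"
| "continued_fraction [a] = Some (of_int a)"
| "continued_fraction (a # b # as) =
    map_option (\<lambda>x. of_int a + x) (reciprocal (continued_fraction (b # as)))"

definition rational_tangle :: "int \<Rightarrow> int \<Rightarrow> diagram \<Rightarrow> bool" where
  "rational_tangle p q T \<longleftrightarrow>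
    (\<exists>as. as \<noteq> [] \<and> continued_fraction as = fraction p q \<and> T = continued_fraction_tangle as)"

text \<open>\<open>replaces S T D D'\<close>: \<open>D'\<close> arises from \<open>D\<close> by replacing a 2-tangle \<open>S\<close> in a disc by \<open>T\<close>.\<close>

definition replaces :: "diagram \<Rightarrow> diagram \<Rightarrow> diagram \<Rightarrow> diagram \<Rightarrow> bool" where
  "replaces S T D D' \<longleftrightarrow> (\<exists>A B i m. tangle 0 A m \<and> i + 2 \<le> m \<and> tangle m B 0 \<and>
    D = A @ shift i S @ B \<and> D' = A @ shift i T @ B)"

text \<open>
  A move on links, not on fixed diagrams: the ball in which it takes place may be brought into
  the standard position required by \<^const>\<open>replaces\<close> by an isotopy.
\<close>

definition rational_move :: "int \<Rightarrow> int \<Rightarrow> diagram \<Rightarrow> diagram \<Rightarrow> bool" where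
  "rational_move p q D D' \<longleftrightarrow> (\<exists>E E' T. isotopic D E \<and> isotopic E' D' \<and> rational_tangle p q T \<and>
    (replaces (integer_tangle 0) T E E' \<or> replaces T (integer_tangle 0) E E'))"

definition n_move :: "nat \<Rightarrow> diagram \<Rightarrow> diagram \<Rightarrow> bool" where
  "n_move n = rational_move (int n) 1"

end

theory Submission
  imports Defs
begin

text \<open>
  \<open>BQ\<^sub>n(L)\<close> represents the colourings of a diagram of \<open>L\<close> by Keis satisfying \<open>r\<^sub>n\<close>.  Hence it is
  unchanged when a tangle in the diagram is replaced by one which, for every such Kei, has the same
  boundary colourings, provided the colours inside both tangles are determined by those on the
  boundary.  This applies to all local moves of isotopy.  By induction along the continued fraction,
  the boundary colourings of the rational tangle \<open>p/q\<close> are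
  \<open>(NW, SW, NE, SE) = (\<psi> 0, \<psi> q, \<psi> (- p), \<psi> (q - p))\<close>, where \<open>\<psi>\<close> is a homomorphism from the integers
  with \<open>i * j = 2j - i\<close>.  The relation \<open>r\<^sub>n\<close> makes \<open>\<psi>\<close> periodic with period \<open>n\<close>, so for \<open>p = n\<close>
  the right colours equal the left ones; and since \<open>q\<close> is invertible modulo \<open>n\<close>, every pair of left
  colours occurs.  These are the boundary colourings of \<open>[0]\<close>.
\<close>

section \<open>Homomorphisms out of quotients\<close>

text \<open>A tangle acts on colours by a relation, not by a map: a cup introduces a colour that
  nothing to its left fixes. Equal boundary relations therefore yield a homomorphism between the two
  Burnside Keis in each direction, but not yet that these are mutually inverse. The composites fix
  all colours outside the tangle; they fix the remaining generators only because the colours inside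
  are determined by both ends together. The positions in the formula for p/q come from arithmetic
  progressions. Any two elements of a Kei are the values at 0 and 1 of a homomorphism from the
  integers. A positive half twist sends the colours at s, s + e to those at s - e, s, so k signed
  half twists shift the pair by -ke. Thus q is the vertical gap and -p the horizontal displacement,
  and a rotation by a right angle interchanges their roles. The mirror image in 1/T costs a sign
  that may fall on either entry. This is harmless: negation is an automorphism of the integers as a
  Kei, so (p, q) and (-p, -q) describe the same boundary colourings.\<close>

definition kei_hom ::
    "('a, 'm) binary_structure_scheme \<Rightarrow> ('b, 'k) binary_structure_scheme \<Rightarrow> ('a \<Rightarrow> 'b) \<Rightarrow> bool" where
  "kei_hom P Q f \<longleftrightarrow> (\<forall>a\<in>carrier P. f a \<in> carrier Q) \<and>
    (\<forall>a\<in>carrier P. \<forall>b\<in>carrier P. f (a \<star>\<^bsub>P\<^esub> b) = f a \<star>\<^bsub>Q\<^esub> f b)"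

text \<open>\<open>H\<close> ranges over arbitrary sets and closure is demanded only inside the
  carrier, so that preimages and equalisers can be inserted for \<open>H\<close> directly.\<close>

definition generates :: "('a, 'm) binary_structure_scheme \<Rightarrow> 'a set \<Rightarrow> bool" where
  "generates P X \<longleftrightarrow> X \<subseteq> carrier P \<and> (\<forall>H. X \<subseteq> H \<longrightarrow>
    (\<forall>a\<in>H \<inter> carrier P. \<forall>b\<in>H \<inter> carrier P. a \<star>\<^bsub>P\<^esub> b \<in> H) \<longrightarrow> carrier P \<subseteq> H)"

definition quotient_class ::
    "('a, 'm) binary_structure_scheme \<Rightarrow> ('a \<times> 'a) set \<Rightarrow> 'a \<Rightarrow> 'a set" where
  "quotient_class Q R a = congruence_generated Q R `` {a}"

text \<open>Weaker than \<open>kei\<close>: the first of the three quotients is taken of the term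
  algebra, where the Kei laws in general fail, and the quotient lemmas below have to cover it
  too.\<close>

definition star_closed :: "('a, 'm) binary_structure_scheme \<Rightarrow> bool" where
  "star_closed Q \<longleftrightarrow> (\<forall>a\<in>carrier Q. \<forall>b\<in>carrier Q. a \<star>\<^bsub>Q\<^esub> b \<in> carrier Q)"

lemma kei_star_closed: "kei Q \<Longrightarrow> star_closed Q"
  by (simp add: star_closed_def kei_closed)

lemma kei_hom_compose:
  "kei_hom P Q f \<Longrightarrow> kei_hom Q R g \<Longrightarrow> kei_hom P R (g \<circ> f)"
  by (simp add: kei_hom_def)

lemma generatesD:
  assumes "generates P X" "X \<subseteq> H"
    and "\<And>a b. a \<in> H \<Longrightarrow> b \<in> H \<Longrightarrow> a \<in> carrier P \<Longrightarrow> b \<in> carrier P \<Longrightarrow> a \<star>\<^bsub>P\<^esub> b \<in> H"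
  shows "carrier P \<subseteq> H"
  using assms by (simp add: generates_def)

lemma generates_hom_eq:
  assumes "generates P X" "kei_hom P Q f" "kei_hom P Q g" "\<And>x. x \<in> X \<Longrightarrow> f x = g x"
    and "a \<in> carrier P"
  shows "f a = g a"
proof -
  \<comment> \<open>The equaliser of two homomorphisms is closed under the product.\<close>
  have "carrier P \<subseteq> {a. f a = g a}"
    by (rule generatesD[OF assms(1)]) (use assms(2-4) in \<open>auto simp: kei_hom_def\<close>)
  then show ?thesis using assms(5) by blast
qed

context
  fixes Q :: "('a, 'm) binary_structure_scheme" and R :: "('a \<times> 'a) set"
  assumes closed: "star_closed Q" and R: "R \<subseteq> carrier Q \<times> carrier Q"
begin

lemma congruence_quotient: "congruence Q (congruence_generated Q R)"
  and relation_subset: "R \<subseteq> congruence_generated Q R"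
  using congruence_generated[OF _ R] closed by (auto simp: star_closed_def)

lemma carrier_quotient_by: "carrier (quotient_by Q R) = quotient_class Q R ` carrier Q"
  by (auto simp: quotient_by_def quotient_def quotient_class_def)

lemma quotient_class_hom: "kei_hom Q (quotient_by Q R) (quotient_class Q R)"
  using star_quotient_by[OF congruence_quotient]
  by (auto simp: kei_hom_def carrier_quotient_by quotient_class_def)

lemma quotient_class_eq: "(a, b) \<in> R \<Longrightarrow> quotient_class Q R a = quotient_class Q R b"
  using congruence_quotient relation_subset
  by (auto simp: quotient_class_def congruence_def intro!: equiv_class_eq)

lemma generates_quotient_by:
  assumes "generates Q X"
  shows "generates (quotient_by Q R) (quotient_class Q R ` X)"
  unfolding generates_def
proof (intro conjI allI impI)
  show "quotient_class Q R ` X \<subseteq> carrier (quotient_by Q R)"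
    using assms by (auto simp: generates_def carrier_quotient_by)
next
  fix H assume X: "quotient_class Q R ` X \<subseteq> H"
    and H: "\<forall>a\<in>H \<inter> carrier (quotient_by Q R). \<forall>b\<in>H \<inter> carrier (quotient_by Q R).
      a \<star>\<^bsub>quotient_by Q R\<^esub> b \<in> H"
  have "carrier Q \<subseteq> quotient_class Q R -` H"
    by (rule generatesD[OF assms]) (use X H quotient_class_hom in \<open>auto simp: kei_hom_def\<close>)
  then show "carrier (quotient_by Q R) \<subseteq> H" by (auto simp: carrier_quotient_by)
qed

text \<open>The kernel of \<open>f\<close> is a congruence containing \<open>R\<close>, hence
  contains the congruence generated by \<open>R\<close>; so \<open>f\<close> is constant on classes
  and can be evaluated at any representative.\<close>

lemma quotient_lift:
  assumes f: "kei_hom Q K f" and eq: "\<And>a b. (a, b) \<in> R \<Longrightarrow> f a = f b"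
  shows "\<exists>g. kei_hom (quotient_by Q R) K g \<and>
    (\<forall>a\<in>carrier Q. g (quotient_class Q R a) = f a)"
proof -
  let ?N = "{(a, b). a \<in> carrier Q \<and> b \<in> carrier Q \<and> f a = f b}"
  have "equiv (carrier Q) ?N"
    by (auto intro!: equivI simp: refl_on_def sym_def trans_def)
  then have "congruence Q ?N"
    using f closed by (auto simp: congruence_def kei_hom_def star_closed_def)
  then have sub: "congruence_generated Q R \<subseteq> ?N"
    using R eq by (auto simp: congruence_generated_def)
  define g where "g A = f (SOME a. a \<in> A)" for A
  have g: "g (quotient_class Q R a) = f a" if a: "a \<in> carrier Q" for a
  proof -
    have "a \<in> quotient_class Q R a"
      unfolding quotient_class_def
      by (rule equiv_class_self[OF _ a]) (use congruence_quotient in \<open>simp add: congruence_def\<close>)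
    then have "(SOME b. b \<in> quotient_class Q R a) \<in> quotient_class Q R a"
      by (rule someI)
    then have "(a, SOME b. b \<in> quotient_class Q R a) \<in> ?N"
      using sub unfolding quotient_class_def by blast
    then show ?thesis by (simp add: g_def)
  qed
  moreover have "kei_hom (quotient_by Q R) K g"
    using quotient_class_hom f g closed
    by (auto simp: kei_hom_def carrier_quotient_by star_closed_def) metis
  ultimately show ?thesis by blast
qed

end

section \<open>The universal property of free Keis\<close>

primrec eval_term :: "('b, 'k) binary_structure_scheme \<Rightarrow> ('g \<Rightarrow> 'b) \<Rightarrow> 'g kei_term \<Rightarrow> 'b" where
  "eval_term K h (Letter x) = h x"
| "eval_term K h (Star s t) = eval_term K h s \<star>\<^bsub>K\<^esub> eval_term K h t"

lemma star_closed_term_algebra: "star_closed (term_algebra X)"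
  by (simp add: star_closed_def term_algebra_def)

lemma kei_laws_subset: "kei_laws X \<subseteq> carrier (term_algebra X) \<times> carrier (term_algebra X)"
  by (auto simp: kei_laws_def term_algebra_def)

lemma generates_term_algebra: "generates (term_algebra X) (Letter ` X)"
proof -
  have "t \<in> H" if "Letter ` X \<subseteq> H" "letters t \<subseteq> X"
    "\<forall>a\<in>H \<inter> {t. letters t \<subseteq> X}. \<forall>b\<in>H \<inter> {t. letters t \<subseteq> X}. Star a b \<in> H" for t H
    using that(2) by (induction t) (use that(1,3) in auto)
  then show ?thesis by (auto simp: generates_def term_algebra_def)
qed

lemma eval_term_closed:
  assumes "kei K" "\<And>x. x \<in> X \<Longrightarrow> h x \<in> carrier K" "letters t \<subseteq> X"
  shows "eval_term K h t \<in> carrier K"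
  using assms(3) by (induction t) (use assms(1,2) in \<open>auto simp: kei_closed\<close>)

lemma free_kei_lift:
  assumes K: "kei K" and h: "\<And>x. x \<in> X \<Longrightarrow> h x \<in> carrier K"
  shows "\<exists>g. kei_hom (free_kei X) K g \<and> (\<forall>x\<in>X. g (free_generator X x) = h x)"
proof -
  have hom: "kei_hom (term_algebra X) K (eval_term K h)"
    by (auto simp: kei_hom_def term_algebra_def intro!: eval_term_closed[OF K h])
  have eq: "eval_term K h s = eval_term K h t" if "(s, t) \<in> kei_laws X" for s t
  proof -
    have closed: "eval_term K h t \<in> carrier K" if "letters t \<subseteq> X" for t
      using that by (intro eval_term_closed[OF K h])
    have K': "u \<star>\<^bsub>K\<^esub> u = u" "(u \<star>\<^bsub>K\<^esub> v) \<star>\<^bsub>K\<^esub> v = u"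
      "(u \<star>\<^bsub>K\<^esub> v) \<star>\<^bsub>K\<^esub> w = (u \<star>\<^bsub>K\<^esub> w) \<star>\<^bsub>K\<^esub> (v \<star>\<^bsub>K\<^esub> w)"
      if "u \<in> carrier K" "v \<in> carrier K" "w \<in> carrier K" for u v w
      using K that unfolding kei_def by blast+
    from that consider (idem) "s = Star t t" "letters t \<subseteq> X"
      | (invol) b where "s = Star (Star t b) b" "letters t \<subseteq> X" "letters b \<subseteq> X"
      | (distrib) a b c where "s = Star (Star a b) c" "t = Star (Star a c) (Star b c)"
        "letters a \<subseteq> X" "letters b \<subseteq> X" "letters c \<subseteq> X"
      unfolding kei_laws_def by blast
    then show ?thesis
    proof cases
      case idem
      note t = closed[OF idem(2)]
      show ?thesis unfolding idem(1) eval_term.simps by (rule K'(1)[OF t t t])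
    next
      case invol
      note b = closed[OF invol(3)]
      show ?thesis
        unfolding invol(1) eval_term.simps by (rule K'(2)[OF closed[OF invol(2)] b b])
    next
      case distrib
      show ?thesis unfolding distrib(1,2) eval_term.simps
        by (intro K'(3) closed distrib)
    qed
  qed
  obtain g where g: "kei_hom (free_kei X) K g"
    "\<forall>a\<in>carrier (term_algebra X).
      g (quotient_class (term_algebra X) (kei_laws X) a) = eval_term K h a"
    using quotient_lift[OF star_closed_term_algebra kei_laws_subset hom eq, folded free_kei_def]
    by blast
  have "g (free_generator X x) = h x" if "x \<in> X" for x
    using g(2)[rule_format, of "Letter x"] that
    by (simp add: term_algebra_def free_generator_def quotient_class_def)
  with g(1) show ?thesis by blast
qed

lemma generates_free_kei: "generates (free_kei X) (free_generator X ` X)"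
proof -
  have "free_generator X ` X = quotient_class (term_algebra X) (kei_laws X) ` Letter ` X"
    by (auto simp: free_generator_def quotient_class_def)
  then show ?thesis
    using generates_quotient_by[OF star_closed_term_algebra kei_laws_subset generates_term_algebra]
    by (simp add: free_kei_def)
qed

section \<open>The universal property of the Burnside Kei\<close>

definition burnside_law :: "nat \<Rightarrow> ('a, 'm) binary_structure_scheme \<Rightarrow> bool" where
  "burnside_law n K \<longleftrightarrow> kei K \<and> (\<forall>u\<in>carrier K. \<forall>w\<in>carrier K. alternating K n u w = u)"

lemma alternating_hom:
  assumes "kei P" "kei_hom P Q f" "a \<in> carrier P" "b \<in> carrier P"
  shows "f (alternating P n a b) = alternating Q n (f a) (f b)"
  using assms(3,4)
proof (induction n arbitrary: a b rule: less_induct)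
  case (less n)
  consider "n = 0" | "n = Suc 0" | m where "n = Suc (Suc m)"
    by (metis not0_implies_Suc)
  then show ?case
  proof cases
    case 3
    then show ?thesis
      using less assms(1,2) alternating_in_carrier[of P b a "Suc m"] by (simp add: kei_hom_def)
  qed simp_all
qed

definition crossing_relations ::
    "diagram \<Rightarrow> ((nat \<times> nat) set kei_term set \<times> (nat \<times> nat) set kei_term set) set" where
  "crossing_relations D = (let F = free_kei (arcs D); g = free_generator (arcs D)
     in {(g c, g a \<star>\<^bsub>F\<^esub> g b) | a b c. crossing D a b c})"

definition burnside_relations :: "nat \<Rightarrow> ('a, 'm) binary_structure_scheme \<Rightarrow> ('a \<times> 'a) set" where
  "burnside_relations n Q = {(u, alternating Q n u w) | u w. u \<in> carrier Q \<and> w \<in> carrier Q}"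

definition arc_class :: "nat \<Rightarrow> diagram \<Rightarrow> (nat \<times> nat) set \<Rightarrow> (nat \<times> nat) set kei_term set set set" where
  "arc_class n D a = quotient_class (link_kei D) (burnside_relations n (link_kei D))
    (quotient_class (free_kei (arcs D)) (crossing_relations D) (free_generator (arcs D) a))"

lemma link_kei_alt: "link_kei D = quotient_by (free_kei (arcs D)) (crossing_relations D)"
  by (simp add: link_kei_def crossing_relations_def Let_def)

lemma burnside_kei_alt:
  "burnside_kei n D = quotient_by (link_kei D) (burnside_relations n (link_kei D))"
  by (simp add: burnside_kei_def burnside_relations_def Let_def)

context
  fixes D :: diagram
  assumes D: "link_diagram D"
begin

lemma crossing_relations_subset:
  "crossing_relations D \<subseteq> carrier (free_kei (arcs D)) \<times> carrier (free_kei (arcs D))"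
  using crossing_in_arcs[OF D] kei_free_kei[of "arcs D"]
  by (fastforce simp: crossing_relations_def Let_def intro!: kei_closed free_generator_in_carrier)

lemma burnside_relations_subset:
  "burnside_relations n (link_kei D) \<subseteq> carrier (link_kei D) \<times> carrier (link_kei D)"
  using kei_link_kei[OF D] by (auto simp: burnside_relations_def intro: alternating_in_carrier)

lemmas free_closed = kei_star_closed[OF kei_free_kei[of "arcs D"]]
lemmas link_closed = kei_star_closed[OF kei_link_kei[OF D]]

lemma burnside_law_burnside_kei: "burnside_law n (burnside_kei n D)"
proof -
  let ?q = "quotient_class (link_kei D) (burnside_relations n (link_kei D))"
  have hom: "kei_hom (link_kei D) (burnside_kei n D) ?q"
    using quotient_class_hom[OF link_closed burnside_relations_subset] by (simp add: burnside_kei_alt)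
  have "alternating (burnside_kei n D) n (?q u) (?q w) = ?q u"
    if "u \<in> carrier (link_kei D)" "w \<in> carrier (link_kei D)" for u w
    using alternating_hom[OF kei_link_kei[OF D] hom that, of n]
      quotient_class_eq[OF link_closed burnside_relations_subset, of u "alternating (link_kei D) n u w" n]
      that by (auto simp: burnside_relations_def)
  then show ?thesis
    using kei_burnside_kei[OF D]
    by (auto simp: burnside_law_def carrier_quotient_by[OF link_closed burnside_relations_subset] burnside_kei_alt)
qed

text \<open>Three successive lifts: to the free Kei, through the crossing relations, and through the
  relations \<open>r_n\<close>. The last is possible because homomorphisms carry alternating words
  to alternating words and the target satisfies the law.\<close>

lemma burnside_kei_lift:
  assumes K: "burnside_law n K" and h: "\<And>a. a \<in> arcs D \<Longrightarrow> h a \<in> carrier K"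
    and cr: "\<And>a b c. crossing D a b c \<Longrightarrow> h c = h a \<star>\<^bsub>K\<^esub> h b"
  shows "\<exists>g. kei_hom (burnside_kei n D) K g \<and> (\<forall>a\<in>arcs D. g (arc_class n D a) = h a)"
proof -
  note gen = free_generator_in_carrier
  have kei: "kei K" using K by (simp add: burnside_law_def)
  obtain g0 where g0: "kei_hom (free_kei (arcs D)) K g0"
    "\<forall>a\<in>arcs D. g0 (free_generator (arcs D) a) = h a"
    using free_kei_lift[of K "arcs D" h, OF kei h] by blast
  have "g0 s = g0 t" if "(s, t) \<in> crossing_relations D" for s t
    using that g0 crossing_in_arcs[OF D] cr
    by (auto simp: crossing_relations_def Let_def kei_hom_def gen)
  then obtain g1 where g1: "kei_hom (link_kei D) K g1"
    "\<forall>a\<in>carrier (free_kei (arcs D)).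
      g1 (quotient_class (free_kei (arcs D)) (crossing_relations D) a) = g0 a"
    using quotient_lift[OF free_closed crossing_relations_subset g0(1), folded link_kei_alt]
    by blast
  have "g1 s = g1 t" if "(s, t) \<in> burnside_relations n (link_kei D)" for s t
    using that alternating_hom[OF kei_link_kei[OF D] g1(1)] K g1(1)
    by (auto simp: burnside_relations_def burnside_law_def kei_hom_def)
  then obtain g where g: "kei_hom (burnside_kei n D) K g"
    "\<forall>a\<in>carrier (link_kei D).
      g (quotient_class (link_kei D) (burnside_relations n (link_kei D)) a) = g1 a"
    using quotient_lift[OF link_closed burnside_relations_subset g1(1), folded burnside_kei_alt]
    by blast
  have "g (arc_class n D a) = h a" if a: "a \<in> arcs D" for a
    using g(2) g1(2) g0(2) a gen[OF a]
      quotient_class_hom[OF free_closed crossing_relations_subset, folded link_kei_alt]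
    by (simp add: arc_class_def kei_hom_def)
  with g(1) show ?thesis by blast
qed

lemma generates_burnside_kei: "generates (burnside_kei n D) (arc_class n D ` arcs D)"
  using generates_quotient_by[OF link_closed burnside_relations_subset[of n]
      generates_quotient_by[OF free_closed crossing_relations_subset generates_free_kei,
        folded link_kei_alt], folded burnside_kei_alt]
  by (simp add: arc_class_def image_comp o_def)

lemma arc_class_in_carrier: "a \<in> arcs D \<Longrightarrow> arc_class n D a \<in> carrier (burnside_kei n D)"
  using generates_burnside_kei[of n] by (auto simp: generates_def)

lemma crossing_arc_class:
  assumes "crossing D a b c"
  shows "arc_class n D c = arc_class n D a \<star>\<^bsub>burnside_kei n D\<^esub> arc_class n D b"
proof -
  let ?F = "free_kei (arcs D)" and ?g = "free_generator (arcs D)"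
  let ?q = "quotient_class ?F (crossing_relations D)"
  have "(?g c, ?g a \<star>\<^bsub>?F\<^esub> ?g b) \<in> crossing_relations D"
    using assms by (auto simp: crossing_relations_def Let_def)
  then have "?q (?g c) = ?q (?g a \<star>\<^bsub>?F\<^esub> ?g b)"
    by (rule quotient_class_eq[OF free_closed crossing_relations_subset])
  moreover have "?g a \<in> carrier ?F" "?g b \<in> carrier ?F"
    using crossing_in_arcs[OF D assms] by (auto intro: free_generator_in_carrier)
  ultimately show ?thesis
    using quotient_class_hom[OF free_closed crossing_relations_subset, folded link_kei_alt]
      quotient_class_hom[OF link_closed burnside_relations_subset[of n], folded burnside_kei_alt]
    by (simp add: arc_class_def kei_hom_def)
qed

end

section \<open>Colourings\<close>

text \<open>
  A colouring of a diagram by a Kei is recorded as the sequence of its states, the state after a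
  slice being the list of the colours of the strands there.
\<close>

fun slice_rel :: "('a, 'm) binary_structure_scheme \<Rightarrow> slice \<Rightarrow> 'a list \<Rightarrow> 'a list \<Rightarrow> bool" where
  "slice_rel K (Cup i) a b \<longleftrightarrow> (\<exists>x\<in>carrier K. a = [] \<and> b = [x, x])"
| "slice_rel K (Cap i) a b \<longleftrightarrow> (\<exists>x\<in>carrier K. a = [x, x] \<and> b = [])"
| "slice_rel K (Cross s i) a b \<longleftrightarrow> (\<exists>x\<in>carrier K. \<exists>y\<in>carrier K. a = [x, y] \<and>
     b = (if s then [y \<star>\<^bsub>K\<^esub> x, x] else [y, x \<star>\<^bsub>K\<^esub> y]))"

text \<open>Cutting the states around the slice suits concatenation and shifting of tangles. The
  indexed forms, which can be compared with points of a diagram, are \<open>step_Cup_iff\<close>,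
  \<open>step_Cap_iff\<close> and \<open>step_Cross_iff\<close>.\<close>

definition step :: "('a, 'm) binary_structure_scheme \<Rightarrow> slice \<Rightarrow> 'a list \<Rightarrow> 'a list \<Rightarrow> bool" where
  "step K x l m \<longleftrightarrow> (\<exists>pre a b post. length pre = position x \<and> slice_rel K x a b \<and>
     l = pre @ a @ post \<and> m = pre @ b @ post)"

text \<open>The list \<open>ss\<close> in \<open>trace K T l ss r\<close> contains the last state \<open>r\<close> but not the first state \<open>l\<close>.\<close>

fun trace :: "('a, 'm) binary_structure_scheme \<Rightarrow> diagram \<Rightarrow> 'a list \<Rightarrow> 'a list list \<Rightarrow> 'a list \<Rightarrow> bool" where
  "trace K [] l ss r \<longleftrightarrow> ss = [] \<and> r = l"
| "trace K (x # T) l ss r \<longleftrightarrow> (\<exists>m ss'. ss = m # ss' \<and> step K x l m \<and> trace K T m ss' r)"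

text \<open>Not a function of \<open>l\<close>: every \<open>Cup\<close> leaves the choice of a
  colour.\<close>

definition boundary_rel :: "('a, 'm) binary_structure_scheme \<Rightarrow> diagram \<Rightarrow> 'a list \<Rightarrow> 'a list \<Rightarrow> bool" where
  "boundary_rel K T l r \<longleftrightarrow> (\<exists>ss. trace K T l ss r)"

lemma trace_append:
  "trace K (S @ T) l ss r \<longleftrightarrow>
    (\<exists>ss1 ss2 m. ss = ss1 @ ss2 \<and> trace K S l ss1 m \<and> trace K T m ss2 r)"
proof (induction S arbitrary: l ss)
  case (Cons x S)
  show ?case by (simp add: Cons) (metis append_Cons)
qed simp

lemma trace_length: "trace K T l ss r \<Longrightarrow> length ss = length T"
  by (induction T arbitrary: l ss) auto

lemma trace_last: "trace K T l ss r \<Longrightarrow> r = last (l # ss)"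
proof (induction T arbitrary: l ss)
  case (Cons x T)
  then obtain m ss' where "ss = m # ss'" "trace K T m ss' r" by auto
  then show ?case using Cons.IH[of m ss'] by simp
qed simp

lemma boundary_rel_Nil [simp]: "boundary_rel K [] l r \<longleftrightarrow> r = l"
  by (simp add: boundary_rel_def)

lemma boundary_rel_Cons:
  "boundary_rel K (x # T) l r \<longleftrightarrow> (\<exists>m. step K x l m \<and> boundary_rel K T m r)"
  by (auto simp: boundary_rel_def)

lemma boundary_rel_append:
  "boundary_rel K (S @ T) l r \<longleftrightarrow> (\<exists>m. boundary_rel K S l m \<and> boundary_rel K T m r)"
  by (induction S arbitrary: l) (auto simp: boundary_rel_Cons)

lemma slice_rel_length: "slice_rel K x a b \<Longrightarrow> length a = slice_in x \<and> length b = slice_out x"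
  by (cases x) auto

lemma step_fits: "step K x l m \<Longrightarrow> slice_fits x (length l) \<and> length m = slice_width x (length l)"
  by (cases x) (auto simp: step_def)

lemma trace_tangle: "trace K T l ss r \<Longrightarrow> tangle (length l) T (length r)"
  by (induction T arbitrary: l ss) (auto, (metis step_fits)+)

lemma step_carrier:
  assumes "kei K" "step K x l m" "set l \<subseteq> carrier K"
  shows "set m \<subseteq> carrier K"
  using assms by (cases x) (auto simp: step_def kei_closed split: if_splits)

lemma trace_carrier:
  "kei K \<Longrightarrow> trace K T l ss r \<Longrightarrow> set l \<subseteq> carrier K \<Longrightarrow> \<forall>s\<in>set ss. set s \<subseteq> carrier K"
proof (induction T arbitrary: l ss)
  case (Cons x T)
  then show ?case by (simp, metis set_ConsD step_carrier)
qed simp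

lemma slice_rel_hom:
  assumes "kei_hom P Q f" "slice_rel P x a b"
  shows "slice_rel Q x (map f a) (map f b)"
  using assms unfolding kei_hom_def by (cases x) (auto intro!: bexI)

lemma step_hom:
  assumes "kei_hom P Q f" "step P x l m"
  shows "step Q x (map f l) (map f m)"
proof -
  obtain pre a b post where "length pre = position x" "slice_rel P x a b"
    "l = pre @ a @ post" "m = pre @ b @ post"
    using assms(2) unfolding step_def by blast
  then have "length (map f pre) = position x" "slice_rel Q x (map f a) (map f b)"
    "map f l = map f pre @ map f a @ map f post" "map f m = map f pre @ map f b @ map f post"
    using slice_rel_hom[OF assms(1)] by auto
  then show ?thesis unfolding step_def by blast
qed

lemma trace_hom:
  "kei_hom P Q f \<Longrightarrow> trace P T l ss r \<Longrightarrow> trace Q T (map f l) (map (map f) ss) (map f r)"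
  by (induction T arbitrary: l ss) (auto intro: step_hom)

lemma trace_nth:
  "trace K T l ss r \<longleftrightarrow> length ss = length T \<and> r = last (l # ss) \<and>
    (\<forall>k<length T. step K (T ! k) ((l # ss) ! k) ((l # ss) ! Suc k))"
proof (induction T arbitrary: l ss)
  case (Cons x T)
  show ?case
    by (cases ss) (auto simp: Cons All_less_Suc2 simp del: last.simps, auto simp: last.simps)
qed auto

lemma step_Cup_iff:
  "step K (Cup i) l m \<longleftrightarrow> i \<le> length l \<and> length m = length l + 2 \<and> (\<forall>j<i. m ! j = l ! j) \<and>
    (\<forall>j. i \<le> j \<longrightarrow> j < length l \<longrightarrow> m ! (j + 2) = l ! j) \<and> m ! i = m ! (i + 1) \<and> m ! i \<in> carrier K"
  (is "?L \<longleftrightarrow> ?R")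
proof
  assume ?L then show ?R by (auto simp: step_def nth_append)
next
  assume R: ?R
  have "m = take i l @ [m ! i, m ! i] @ drop i l"
  proof (rule nth_equalityI)
    fix j assume j: "j < length m"
    consider "j < i" | "j = i" | "j = i + 1" | j' where "j = j' + 2" "i \<le> j'"
    proof (cases "i + 2 \<le> j")
      case True
      then show ?thesis using that(4)[of "j - 2"] by simp
    qed (use that(1-3) in linarith)
    then show "m ! j = (take i l @ [m ! i, m ! i] @ drop i l) ! j"
      by cases (use R j in \<open>auto simp: nth_append\<close>)
  qed (use R in auto)
  then have "\<exists>pre a b post. length pre = i \<and> slice_rel K (Cup i) a b \<and> l = pre @ a @ post \<and> m = pre @ b @ post"
    using R by (intro exI[of _ "take i l"] exI[of _ "[]"] exI[of _ "[m ! i, m ! i]"] exI[of _ "drop i l"]) auto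
  then show ?L by (simp add: step_def)
qed

lemma step_Cap_iff: "step K (Cap i) l m \<longleftrightarrow> step K (Cup i) m l"
  by (auto simp: step_def)

lemma step_Cross_iff:
  "step K (Cross s i) l m \<longleftrightarrow> i + 2 \<le> length l \<and> length m = length l \<and>
    (\<forall>j<length l. j \<noteq> i \<longrightarrow> j \<noteq> i + 1 \<longrightarrow> m ! j = l ! j) \<and> l ! i \<in> carrier K \<and> l ! (i + 1) \<in> carrier K \<and>
    (if s then m ! i = l ! (i + 1) \<star>\<^bsub>K\<^esub> l ! i \<and> m ! (i + 1) = l ! i
     else m ! i = l ! (i + 1) \<and> m ! (i + 1) = l ! i \<star>\<^bsub>K\<^esub> l ! (i + 1))"
  (is "?L \<longleftrightarrow> ?R")
proof
  assume ?L then show ?R by (auto simp: step_def nth_append nth_Cons')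
next
  assume R: ?R
  have split: "l' = take i l @ [l' ! i, l' ! (i + 1)] @ drop (i + 2) l"
    if l': "length l' = length l" "\<And>j. j < length l \<Longrightarrow> j \<noteq> i \<Longrightarrow> j \<noteq> i + 1 \<Longrightarrow> l' ! j = l ! j" for l'
  proof (rule nth_equalityI)
    fix j assume j: "j < length l'"
    consider "j < i" | "j = i" | "j = i + 1" | j' where "j = j' + 2" "i \<le> j'"
    proof (cases "i + 2 \<le> j")
      case True
      then show ?thesis using that(4)[of "j - 2"] by simp
    qed (use that(1-3) in linarith)
    then show "l' ! j = (take i l @ [l' ! i, l' ! (i + 1)] @ drop (i + 2) l) ! j"
      by cases (use R j l' in \<open>auto simp: nth_append\<close>)
  qed (use R l' in auto)
  have l: "l = take i l @ [l ! i, l ! (i + 1)] @ drop (i + 2) l"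
    by (rule split) auto
  have m: "m = take i l @ [m ! i, m ! (i + 1)] @ drop (i + 2) l"
    by (rule split) (use R in auto)
  have "slice_rel K (Cross s i) [l ! i, l ! (i + 1)] [m ! i, m ! (i + 1)]"
    using R by auto
  moreover have "length (take i l) = i" using R by simp
  ultimately show ?L unfolding step_def position.simps using l m by blast
qed

section \<open>Colours of points and arcs\<close>

definition width :: "diagram \<Rightarrow> nat \<Rightarrow> nat" where
  "width D k = fold slice_width (take k D) 0"

text \<open>The empty list in front is the state before the first slice, so that state
  \<open>k\<close> has index \<open>k\<close>, as in \<open>points\<close>.\<close>

definition colour :: "'a list list \<Rightarrow> nat \<times> nat \<Rightarrow> 'a" where
  "colour ss p = ([] # ss) ! fst p ! snd p"

lemma width_Suc: "k < length D \<Longrightarrow> width D (Suc k) = slice_width (D ! k) (width D k)"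
  by (simp add: width_def take_Suc_conv_app_nth)

lemma points_width: "(k, j) \<in> points D \<longleftrightarrow> k \<le> length D \<and> j < width D k"
  by (simp add: points_def width_def)

lemma trace_width:
  assumes "trace K D [] ss []" "k \<le> length D"
  shows "length (([] # ss) ! k) = width D k"
  using assms(2)
proof (induction k)
  case (Suc k)
  then have k: "k < length D" by simp
  then have "step K (D ! k) (([] # ss) ! k) (([] # ss) ! Suc k)"
    using assms(1) unfolding trace_nth by blast
  from step_fits[OF this] show ?case using Suc k by (simp add: width_Suc)
qed (simp add: width_def)

lemma trace_step:
  assumes "trace K D [] ss []" "k < length D"
  shows "step K (D ! k) (([] # ss) ! k) (([] # ss) ! Suc k)"
    and "length (([] # ss) ! k) = width D k" "length (([] # ss) ! Suc k) = width D (Suc k)"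
proof -
  show "step K (D ! k) (([] # ss) ! k) (([] # ss) ! Suc k)"
    using assms unfolding trace_nth by blast
  show "length (([] # ss) ! k) = width D k" "length (([] # ss) ! Suc k) = width D (Suc k)"
    using trace_width[OF assms(1), of k] trace_width[OF assms(1), of "Suc k"] assms(2) by simp_all
qed

text \<open>\<open>adjacent\<close> does not bound the strand numbers by the width, so membership in
  \<open>points\<close> has to be carried along. Assuming it at either end allows the generated
  equivalence to be followed in both directions.\<close>

lemma colour_adjacent:
  assumes tr: "trace K D [] ss []" and adj: "adjacent D p q" and p: "p \<in> points D \<or> q \<in> points D"
  shows "p \<in> points D \<and> q \<in> points D \<and> colour ss p = colour ss q"
proof -
  note st = trace_step(1)[OF tr] and wk = trace_step(2,3)[OF tr]
  show ?thesis
    using adj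
  proof cases
    case (cup_above k i j)
    then show ?thesis using st[of k] wk[of k] p
      by (auto simp: step_Cup_iff points_width colour_def)
  next
    case (cup_below k i j)
    then show ?thesis using st[of k] wk[of k] p
      by (auto simp: step_Cup_iff points_width colour_def)
  next
    case (cup_turn k i)
    then show ?thesis using st[of k] wk[of k] p
      by (auto simp: step_Cup_iff points_width colour_def)
  next
    case (cap_above k i j)
    then show ?thesis using st[of k] wk[of k] p
      by (auto simp: step_Cap_iff step_Cup_iff points_width colour_def)
  next
    case (cap_below k i j)
    then show ?thesis using st[of k] wk[of k] p
      by (auto simp: step_Cap_iff step_Cup_iff points_width colour_def)
  next
    case (cap_turn k i)
    then show ?thesis using st[of k] wk[of k] p
      by (auto simp: step_Cap_iff step_Cup_iff points_width colour_def)
  next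
    case (cross_away k s i j)
    then show ?thesis using st[of k] wk[of k] p
      by (auto simp: step_Cross_iff points_width colour_def split: if_splits)
  next
    case (over_down k i)
    then show ?thesis using st[of k] wk[of k] p
      by (auto simp: step_Cross_iff points_width colour_def split: if_splits)
  next
    case (over_up k i)
    then show ?thesis using st[of k] wk[of k] p
      by (auto simp: step_Cross_iff points_width colour_def split: if_splits)
  qed
qed

lemma colour_arc:
  assumes tr: "trace K D [] ss []" and p: "p \<in> points D" and q: "q \<in> arc_of D p"
  shows "colour ss q = colour ss p"
proof -
  have "equivclp (adjacent D) p q" using q by (simp add: arc_of_def)
  then have "q \<in> points D \<and> colour ss q = colour ss p"
  proof (induction rule: equivclp_induct)
    case base
    show ?case using p by simp
  next
    case (step q r)
    then show ?case using colour_adjacent[OF tr, of q r] colour_adjacent[OF tr, of r q] by auto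
  qed
  then show ?thesis ..
qed

lemma arc_of_adjacent: "adjacent D p q \<Longrightarrow> arc_of D p = arc_of D q"
  unfolding arc_of_def
  by (auto intro: equivclp_trans equivclp_sym r_into_equivclp)

lemma arc_of_self: "p \<in> arc_of D p"
  by (simp add: arc_of_def)

section \<open>The universal colouring\<close>

definition arc_state :: "nat \<Rightarrow> diagram \<Rightarrow> nat \<Rightarrow> (nat \<times> nat) set kei_term set set set list" where
  "arc_state n D k = map (\<lambda>j. arc_class n D (arc_of D (k, j))) [0..<width D k]"

text \<open>Indices start at 1 because \<open>trace\<close> leaves out the first state, here the
  empty one.\<close>

definition arc_states :: "nat \<Rightarrow> diagram \<Rightarrow> (nat \<times> nat) set kei_term set set set list list" where
  "arc_states n D = map (arc_state n D) [1..<Suc (length D)]"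

lemma arc_states_nth: "k \<le> length D \<Longrightarrow> ([] # arc_states n D) ! k = arc_state n D k"
  by (cases k) (auto simp: arc_states_def arc_state_def width_def simp del: upt_Suc)

lemma trace_arc_states:
  assumes D: "link_diagram D"
  shows "trace (burnside_kei n D) D [] (arc_states n D) []"
  unfolding trace_nth
proof (intro conjI allI impI)
  show "length (arc_states n D) = length D" by (simp add: arc_states_def del: upt_Suc)
  have "width D (length D) = 0"
    using D tangle_width by (simp add: width_def link_diagram_def)
  then show "[] = last ([] # arc_states n D)"
    using arc_states_nth[of "length D" D n]
    by (cases D rule: rev_cases) (auto simp: last_conv_nth arc_states_def arc_state_def)
next
  fix k assume k: "k < length D"
  have fits: "slice_fits (D ! k) (width D k)"
    using slice_fits_nth[of D 0 k] D k by (simp add: link_diagram_def width_def)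
  have in_arcs: "arc_of D (k', j) \<in> arcs D" if "k' \<le> length D" "j < width D k'" for k' j
    using that by (auto simp: arcs_def points_width)
  have "step (burnside_kei n D) (D ! k) (arc_state n D k) (arc_state n D (Suc k))"
  proof (cases "D ! k")
    case (Cup i)
    have "arc_of D (Suc k, j) = arc_of D (k, j)" if "j < i" for j
      using arc_of_adjacent[OF cup_above[OF k Cup that]] by simp
    moreover have "arc_of D (Suc k, Suc (Suc j)) = arc_of D (k, j)" if "i \<le> j" for j
      using arc_of_adjacent[OF cup_below[OF k Cup that]] by simp
    moreover have "arc_of D (Suc k, i) = arc_of D (Suc k, Suc i)"
      using arc_of_adjacent[OF cup_turn[OF k Cup]] by simp
    ultimately show ?thesis
      using Cup fits k in_arcs[of "Suc k" "Suc i"]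
      by (auto simp: step_Cup_iff arc_state_def width_Suc arc_class_in_carrier[OF D] simp del: upt_Suc)
  next
    case (Cap i)
    have "arc_of D (Suc k, j) = arc_of D (k, j)" if "j < i" for j
      using arc_of_adjacent[OF cap_above[OF k Cap that]] by simp
    moreover have "arc_of D (k, Suc (Suc j)) = arc_of D (Suc k, j)" if "i \<le> j" for j
      using arc_of_adjacent[OF cap_below[OF k Cap that]] by simp
    moreover have "arc_of D (k, i) = arc_of D (k, Suc i)"
      using arc_of_adjacent[OF cap_turn[OF k Cap]] by simp
    ultimately show ?thesis
      using Cap fits k in_arcs[of k "Suc i"]
      by (auto simp: step_Cap_iff step_Cup_iff arc_state_def width_Suc arc_class_in_carrier[OF D] simp del: upt_Suc)
  next
    case (Cross s i)
    have "arc_of D (Suc k, j) = arc_of D (k, j)" if "j \<noteq> i" "j \<noteq> i + 1" for j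
      using arc_of_adjacent[OF cross_away[OF k Cross that]] by simp
    \<comment> \<open>The overstrand stays in its arc; the new understrand is related to the old one
      by the crossing relation.\<close>
    moreover have "if s then arc_of D (Suc k, Suc i) = arc_of D (k, i)
        else arc_of D (Suc k, i) = arc_of D (k, Suc i)"
      using arc_of_adjacent[OF over_down[OF k]] arc_of_adjacent[OF over_up[OF k]] Cross by auto
    moreover have "if s then crossing D (arc_of D (k, Suc i)) (arc_of D (k, i)) (arc_of D (Suc k, i))
        else crossing D (arc_of D (k, i)) (arc_of D (k, Suc i)) (arc_of D (Suc k, Suc i))"
      using crossing.intros[OF k] Cross by auto
    ultimately show ?thesis
      using Cross fits k in_arcs[of k i] in_arcs[of k "Suc i"] crossing_arc_class[OF D, where n = n]
      by (auto simp: step_Cross_iff arc_state_def width_Suc arc_class_in_carrier[OF D] split: if_splits simp del: upt_Suc)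
  qed
  then show "step (burnside_kei n D) (D ! k) (([] # arc_states n D) ! k) (([] # arc_states n D) ! Suc k)"
    using k by (simp only: arc_states_nth less_imp_le Suc_le_eq)
qed

text \<open>A colouring is constant on arcs and obeys the crossing relations, so it is an assignment
  to the generators to which \<open>burnside_kei_lift\<close> applies.\<close>

lemma burnside_kei_universal:
  assumes D: "link_diagram D" and K: "burnside_law n K" and tr: "trace K D [] ss []"
  shows "\<exists>f. kei_hom (burnside_kei n D) K f \<and> map (map f) (arc_states n D) = ss"
proof -
  \<comment> \<open>By \<open>colour_arc\<close> the chosen point of the arc does not influence the
    colour.\<close>
  define h where "h A = colour ss (SOME p. p \<in> A)" for A
  have h: "h (arc_of D p) = colour ss p" if "p \<in> points D" for p
    using colour_arc[OF tr that] someI[of "\<lambda>q. q \<in> arc_of D p", OF arc_of_self] by (simp add: h_def)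
  have kei: "kei K" using K by (simp add: burnside_law_def)
  have len: "length ss = length D" using tr by (rule trace_length)
  have "h a \<in> carrier K" if a: "a \<in> arcs D" for a
  proof -
    obtain k j where kj: "a = arc_of D (k, j)" "(k, j) \<in> points D" using a by (auto simp: arcs_def)
    then have "j < length (([] # ss) ! k)" "k \<le> length D"
      using trace_width[OF tr] by (auto simp: points_width)
    moreover have "set (([] # ss) ! k) \<subseteq> carrier K"
      using trace_carrier[OF kei tr] \<open>k \<le> length D\<close> len
      by (cases k) auto
    ultimately show ?thesis using h kj by (auto simp: colour_def dest: nth_mem)
  qed
  moreover have "h c = h a \<star>\<^bsub>K\<^esub> h b" if "crossing D a b c" for a b c
  proof -
    note st = trace_step(1)[OF tr] and wk = trace_step(2,3)[OF tr]
    show ?thesis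
      using that
    proof cases
      case (1 k i)
      then show ?thesis using st[of k] wk[of k] h
        by (auto simp: step_Cross_iff points_width colour_def)
    next
      case (2 k i)
      then show ?thesis using st[of k] wk[of k] h
        by (auto simp: step_Cross_iff points_width colour_def)
    qed
  qed
  ultimately obtain f where f: "kei_hom (burnside_kei n D) K f" "\<forall>a\<in>arcs D. f (arc_class n D a) = h a"
    using burnside_kei_lift[OF D K] by blast
  have "map f (arc_state n D k) = ([] # ss) ! k" if "k \<le> length D" for k
    using that f(2) h trace_width[OF tr that]
    by (auto intro!: nth_equalityI simp: arc_state_def arcs_def points_width colour_def)
  from this[of "Suc _"] have "map (map f) (arc_states n D) = ss"
    by (auto intro!: nth_equalityI simp: arc_states_def len simp del: upt_Suc)
  with f(1) show ?thesis by blast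
qed

text \<open>Every arc class is an entry of the universal colouring, and the arc classes
  generate.\<close>

lemma burnside_hom_eq:
  assumes D: "link_diagram D" and "kei_hom (burnside_kei n D) K f" "kei_hom (burnside_kei n D) K g"
    and eq: "map (map f) (arc_states n D) = map (map g) (arc_states n D)"
    and a: "a \<in> carrier (burnside_kei n D)"
  shows "f a = g a"
proof (rule generates_hom_eq[OF generates_burnside_kei[OF D] assms(2,3) _ a])
  fix x assume "x \<in> arc_class n D ` arcs D"
  then obtain k j where x: "x = arc_class n D (arc_of D (k, j))" "(k, j) \<in> points D"
    by (auto simp: arcs_def)
  then have kj: "k \<le> length D" "j < width D k" by (auto simp: points_width)
  have "map (map f) ([] # arc_states n D) ! k = map (map g) ([] # arc_states n D) ! k"
    using eq by (simp only: list.map)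
  then have "map f (arc_state n D k) = map g (arc_state n D k)"
    using kj arc_states_nth[OF kj(1), of n]
    by (metis (no_types, lifting) arc_states_def le_imp_less_Suc length_Cons length_map length_upt
        diff_Suc_1 nth_map)
  then show "f x = g x"
    using x kj by (auto simp: arc_state_def)
qed

section \<open>Replacing one tangle by another\<close>

lemma kei_isomorphic_refl: "Q \<cong>\<^sub>K Q"
  unfolding kei_isomorphic_def by (rule exI[of _ id]) auto

lemma kei_isomorphic_trans:
  assumes "P \<cong>\<^sub>K Q" "Q \<cong>\<^sub>K R"
  shows "P \<cong>\<^sub>K R"
proof -
  obtain f g where f: "bij_betw f (carrier P) (carrier Q)"
      "\<forall>a\<in>carrier P. \<forall>b\<in>carrier P. f (a \<star>\<^bsub>P\<^esub> b) = f a \<star>\<^bsub>Q\<^esub> f b"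
    and g: "bij_betw g (carrier Q) (carrier R)"
      "\<forall>a\<in>carrier Q. \<forall>b\<in>carrier Q. g (a \<star>\<^bsub>Q\<^esub> b) = g a \<star>\<^bsub>R\<^esub> g b"
    using assms unfolding kei_isomorphic_def by blast
  have "\<forall>a\<in>carrier P. f a \<in> carrier Q" using f(1) by (auto simp: bij_betw_def)
  then show ?thesis
    unfolding kei_isomorphic_def using bij_betw_trans[OF f(1) g(1)] f(2) g(2)
    by (intro exI[of _ "g \<circ> f"]) auto
qed

lemma kei_isomorphic_inverse_homs:
  assumes "kei_hom P Q f" "kei_hom Q P g"
    and "\<And>a. a \<in> carrier P \<Longrightarrow> g (f a) = a" "\<And>b. b \<in> carrier Q \<Longrightarrow> f (g b) = b"
  shows "P \<cong>\<^sub>K Q"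
  unfolding kei_isomorphic_def
  using assms by (intro exI[of _ f] conjI bij_betw_byWitness[where f' = g]) (auto simp: kei_hom_def)

text \<open>Both ends are prescribed: after a cup, the left end alone does not determine the
  states.\<close>

definition boundary_determined ::
    "('a, 'm) binary_structure_scheme \<Rightarrow> nat \<Rightarrow> diagram \<Rightarrow> bool" where
  "boundary_determined K m T \<longleftrightarrow> (\<forall>l r ss ss'. length l = m \<longrightarrow>
     trace K T l ss r \<longrightarrow> trace K T l ss' r \<longrightarrow> ss = ss')"

text \<open>The empty word relates every list to itself, whereas a slice forces the colours that it
  touches into the carrier; hence the restriction on \<open>l\<close>.\<close>

definition exchangeable ::
    "('a, 'm) binary_structure_scheme \<Rightarrow> nat \<Rightarrow> diagram \<Rightarrow> diagram \<Rightarrow> bool" where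
  "exchangeable K m S T \<longleftrightarrow> boundary_determined K m S \<and> boundary_determined K m T \<and>
     (\<forall>l r. length l = m \<longrightarrow> set l \<subseteq> carrier K \<longrightarrow> boundary_rel K S l r = boundary_rel K T l r)"

lemma exchangeable_sym: "exchangeable K m S T \<Longrightarrow> exchangeable K m T S"
  by (auto simp: exchangeable_def)

context
  fixes A B :: diagram and n m :: nat
  assumes A: "tangle 0 A m"
begin

text \<open>
  The universal colouring of \<open>A @ S @ B\<close> agrees outside \<open>S\<close> with a colouring of \<open>A @ T @ B\<close>.
\<close>

lemma exchange_hom:
  fixes S T
  defines "P \<equiv> burnside_kei n (A @ S @ B)" and "P' \<equiv> burnside_kei n (A @ T @ B)"
  assumes D: "link_diagram (A @ S @ B)" and D': "link_diagram (A @ T @ B)"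
    and ex: "exchangeable P m S T"
    and u: "arc_states n (A @ S @ B) = ua @ us @ ub" "length ua = length A" "length us = length S"
    and v: "arc_states n (A @ T @ B) = va @ vs @ vb" "length va = length A" "length vs = length T"
  shows "\<exists>f. kei_hom P' P f \<and> map (map f) va = ua \<and> map (map f) vb = ub \<and>
    map f (last (last ([] # va) # vs)) = last (last ([] # ua) # us)"
proof -
  have law: "burnside_law n P" unfolding P_def by (rule burnside_law_burnside_kei[OF D])
  then have kei: "kei P" by (simp add: burnside_law_def)
  have "trace P (A @ S @ B) [] (ua @ us @ ub) []"
    unfolding P_def u(1)[symmetric] by (rule trace_arc_states[OF D])
  then obtain ua' us' ub' l r where eq: "ua @ us @ ub = ua' @ us' @ ub'"
    and t': "trace P A [] ua' l" "trace P S l us' r" "trace P B r ub' []"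
    unfolding trace_append by blast
  have "length ua' = length A" "length us' = length S" using t' trace_length by blast+
  with eq u have "ua = ua'" "us = us'" "ub = ub'" by auto
  with t' have t: "trace P A [] ua l" "trace P S l us r" "trace P B r ub []" by simp_all
  \<comment> \<open>\<open>last ([] # ua)\<close> is the state just left of \<open>S\<close> and
    \<open>last (last ([] # ua) # us)\<close> the one just right of it; the prepended entries cover
    empty \<open>A\<close> and empty \<open>S\<close>.\<close>
  note l = trace_last[OF t(1)] and r = trace_last[OF t(2)]
  have len: "length l = m" using tangle_width[OF trace_tangle[OF t(1)]] tangle_width[OF A] by simp
  have "set l \<subseteq> carrier P"
    using trace_carrier[OF kei t(1)] l by (cases ua rule: rev_cases) auto
  \<comment> \<open>Equality of the boundary relations provides some colouring of \<open>T\<close>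
    that fits between the same two states.\<close>
  then obtain ts where ts: "trace P T l ts r"
    using ex t(2) len unfolding exchangeable_def boundary_rel_def by blast
  have "trace P (A @ T @ B) [] (ua @ ts @ ub) []"
    unfolding trace_append using t ts by blast
  then obtain f where f: "kei_hom P' P f" "map (map f) (va @ vs @ vb) = ua @ ts @ ub"
    unfolding P'_def v(1)[symmetric] using burnside_kei_universal[OF D' law] by blast
  have "length ts = length T" using ts trace_length by blast
  with f(2) u v have m: "map (map f) va = ua" "map (map f) vs = ts" "map (map f) vb = ub"
    by auto
  have "map f (last (last ([] # va) # vs)) = last (map (map f) (last ([] # va) # vs))"
    by (simp add: last_map)
  also have "\<dots> = last (last (map (map f) ([] # va)) # ts)"
    using m(2) by (simp add: last_map)
  also have "\<dots> = r" using m(1) l trace_last[OF ts] by simp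
  finally show ?thesis using f(1) m r l by auto
qed

text \<open>The endomorphism \<open>h\<close> fixes both boundary states of \<open>S\<close>, so it
  maps the colouring inside \<open>S\<close> to one with the same boundary, that is, to itself. All
  arc classes are then fixed. The right boundary state is the last entry of \<open>us\<close> unless
  \<open>S\<close> is empty, so its invariance does not follow from that of \<open>ua\<close> and
  \<open>ub\<close> and is assumed separately.\<close>

lemma exchange_retract:
  fixes S T
  defines "P \<equiv> burnside_kei n (A @ S @ B)" and "P' \<equiv> burnside_kei n (A @ T @ B)"
  assumes D: "link_diagram (A @ S @ B)" and ex: "exchangeable P m S T"
    and u: "arc_states n (A @ S @ B) = ua @ us @ ub" "length ua = length A" "length us = length S"
    and h: "kei_hom P P h" "map (map h) ua = ua" "map (map h) ub = ub"
      "map h (last (last ([] # ua) # us)) = last (last ([] # ua) # us)"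
    and a: "a \<in> carrier P"
  shows "h a = a"
proof -
  have "trace P (A @ S @ B) [] (ua @ us @ ub) []"
    unfolding P_def u(1)[symmetric] by (rule trace_arc_states[OF D])
  then obtain ua' us' ub' l r where eq: "ua @ us @ ub = ua' @ us' @ ub'"
    and t': "trace P A [] ua' l" "trace P S l us' r" "trace P B r ub' []"
    unfolding trace_append by blast
  have "length ua' = length A" "length us' = length S" using t' trace_length by blast+
  with eq u have "ua = ua'" "us = us'" "ub = ub'" by auto
  with t' have t: "trace P A [] ua l" "trace P S l us r" by simp_all
  note l = trace_last[OF t(1)] and r = trace_last[OF t(2)]
  have len: "length l = m" using tangle_width[OF trace_tangle[OF t(1)]] tangle_width[OF A] by simp
  have "map h l = last (map (map h) ([] # ua))" unfolding l by (rule last_map[symmetric]) simp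
  then have hl: "map h l = l" using h(2) l by simp
  have "map h r = r" using h(4) l r by simp
  then have "trace P S l (map (map h) us) r" using trace_hom[OF h(1) t(2)] hl by simp
  then have "map (map h) us = us"
    using ex t(2) len unfolding exchangeable_def boundary_determined_def by blast
  then have "map (map h) (arc_states n (A @ S @ B)) = map (map id) (arc_states n (A @ S @ B))"
    using u h by simp
  moreover have "kei_hom P P id" by (simp add: kei_hom_def)
  ultimately have "h a = id a"
    using h(1) a unfolding P_def by (intro burnside_hom_eq[OF D])
  then show ?thesis by simp
qed

text \<open>The Burnside Keis of all diagrams share one type, so exchangeability over Keis of that
  single type covers both targets. The two homomorphisms from \<open>exchange_hom\<close> are
  mutually inverse by \<open>exchange_retract\<close>.\<close>

lemma burnside_kei_exchange:
  fixes S T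
  assumes D: "link_diagram (A @ S @ B)" and D': "link_diagram (A @ T @ B)"
    and ex: "\<And>K :: (nat \<times> nat) set kei_term set set set binary_structure.
      burnside_law n K \<Longrightarrow> exchangeable K m S T"
  shows "burnside_kei n (A @ S @ B) \<cong>\<^sub>K burnside_kei n (A @ T @ B)"
proof -
  let ?P = "burnside_kei n (A @ S @ B)" and ?P' = "burnside_kei n (A @ T @ B)"
  have exS: "exchangeable ?P m S T" and exT: "exchangeable ?P' m T S"
    using ex burnside_law_burnside_kei[OF D] burnside_law_burnside_kei[OF D'] exchangeable_sym by blast+
  have split: "\<exists>ua us ub. arc_states n (A @ X @ B) = ua @ us @ ub \<and> length ua = length A \<and>
    length us = length X" for X
    by (rule exI[of _ "take (length A) (arc_states n (A @ X @ B))"],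
        rule exI[of _ "take (length X) (drop (length A) (arc_states n (A @ X @ B)))"],
        rule exI[of _ "drop (length X) (drop (length A) (arc_states n (A @ X @ B)))"])
      (simp add: arc_states_def min_def del: upt_Suc drop_drop)
  obtain ua us ub where u: "arc_states n (A @ S @ B) = ua @ us @ ub" "length ua = length A"
    "length us = length S" using split by blast
  obtain va vs vb where v: "arc_states n (A @ T @ B) = va @ vs @ vb" "length va = length A"
    "length vs = length T" using split by blast
  obtain f where f: "kei_hom ?P' ?P f" "map (map f) va = ua" "map (map f) vb = ub"
    "map f (last (last ([] # va) # vs)) = last (last ([] # ua) # us)"
    using exchange_hom[OF D D' exS u v] by blast
  obtain g where g: "kei_hom ?P ?P' g" "map (map g) ua = va" "map (map g) ub = vb"
    "map g (last (last ([] # ua) # us)) = last (last ([] # va) # vs)"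
    using exchange_hom[OF D' D exT v u] by blast
  have comp: "map (map (p \<circ> q)) xs = map (map p) (map (map q) xs)"
    "map (p \<circ> q) ys = map p (map q ys)" for p q xs ys
    by simp_all
  have "(f \<circ> g) a = a" if "a \<in> carrier ?P" for a
    by (rule exchange_retract[OF D exS u kei_hom_compose[OF g(1) f(1)] _ _ _ that])
      (simp_all only: comp f g)
  moreover have "(g \<circ> f) a = a" if "a \<in> carrier ?P'" for a
    by (rule exchange_retract[OF D' exT v kei_hom_compose[OF f(1) g(1)] _ _ _ that])
      (simp_all only: comp f g)
  ultimately show ?thesis
    using kei_isomorphic_inverse_homs[OF g(1) f(1)] by simp
qed

end

section \<open>Invariance under isotopy\<close>

lemma kei_idem: "kei K \<Longrightarrow> a \<in> carrier K \<Longrightarrow> a \<star>\<^bsub>K\<^esub> a = a"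
  unfolding kei_def by blast

lemma kei_invol: "kei K \<Longrightarrow> a \<in> carrier K \<Longrightarrow> b \<in> carrier K \<Longrightarrow> (a \<star>\<^bsub>K\<^esub> b) \<star>\<^bsub>K\<^esub> b = a"
  unfolding kei_def by blast

lemma kei_distrib:
  "kei K \<Longrightarrow> a \<in> carrier K \<Longrightarrow> b \<in> carrier K \<Longrightarrow> c \<in> carrier K \<Longrightarrow>
    (a \<star>\<^bsub>K\<^esub> c) \<star>\<^bsub>K\<^esub> (b \<star>\<^bsub>K\<^esub> c) = (a \<star>\<^bsub>K\<^esub> b) \<star>\<^bsub>K\<^esub> c"
  unfolding kei_def by metis

text \<open>Translation by b * c is translation by b conjugated by translation by c. In this
  orientation the law rewrites products that arise in the third Reidemeister move.\<close>

lemma kei_distrib_conjugate: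
  assumes "kei K" "a \<in> carrier K" "b \<in> carrier K" "c \<in> carrier K"
  shows "(a \<star>\<^bsub>K\<^esub> (b \<star>\<^bsub>K\<^esub> c)) \<star>\<^bsub>K\<^esub> c = (a \<star>\<^bsub>K\<^esub> c) \<star>\<^bsub>K\<^esub> b"
  using kei_distrib[OF assms(1,2) kei_closed[OF assms(1,3,4)] assms(4)] kei_invol[OF assms(1,3,4)]
  by simp

lemmas kei_simps = kei_idem kei_invol kei_closed kei_distrib kei_distrib_conjugate

section \<open>Evaluating slices on states split at their position\<close>

lemma step_append_iff:
  assumes "length pre = position x"
  shows "step K x (pre @ rest) m \<longleftrightarrow>
    (\<exists>a b post. slice_rel K x a b \<and> rest = a @ post \<and> m = pre @ b @ post)"
proof
  assume "step K x (pre @ rest) m"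
  then obtain pre' a b post where *: "length pre' = position x" "slice_rel K x a b"
    "pre @ rest = pre' @ a @ post" "m = pre' @ b @ post" unfolding step_def by blast
  have "length pre = length pre'" using *(1) assms by simp
  then have "pre' = pre" "rest = a @ post" using *(3) by simp_all
  then show "\<exists>a b post. slice_rel K x a b \<and> rest = a @ post \<and> m = pre @ b @ post"
    using * by blast
qed (use assms in \<open>auto simp: step_def\<close>)

lemma step_Cup_append:
  "length pre = i \<Longrightarrow> step K (Cup i) (pre @ post) m \<longleftrightarrow> (\<exists>x\<in>carrier K. m = pre @ x # x # post)"
  by (subst step_append_iff) auto

lemma step_Cap_append:
  "length pre = i \<Longrightarrow> step K (Cap i) (pre @ x # y # post) m \<longleftrightarrow> y = x \<and> x \<in> carrier K \<and> m = pre @ post"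
  by (subst step_append_iff) auto

lemma step_Cross_append:
  "length pre = i \<Longrightarrow> step K (Cross s i) (pre @ x # y # post) m \<longleftrightarrow> x \<in> carrier K \<and> y \<in> carrier K \<and>
    m = pre @ (if s then y \<star>\<^bsub>K\<^esub> x else y) # (if s then x else x \<star>\<^bsub>K\<^esub> y) # post"
  (is "?pre \<Longrightarrow> ?L \<longleftrightarrow> ?R")
proof
  assume "?pre" ?L
  then show ?R by (subst (asm) step_append_iff) (auto split: if_splits)
next
  assume len: "?pre" and R: ?R
  have "slice_rel K (Cross s i) [x, y]
    [if s then y \<star>\<^bsub>K\<^esub> x else y, if s then x else x \<star>\<^bsub>K\<^esub> y]" using R by auto
  moreover have "length pre = position (Cross s i)" using len by simp
  ultimately show ?L using R unfolding step_def by fastforce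
qed

lemma boundary_rel_Cup_append:
  "length pre = i \<Longrightarrow> boundary_rel K (Cup i # T) (pre @ post) r \<longleftrightarrow>
    (\<exists>x\<in>carrier K. boundary_rel K T (pre @ x # x # post) r)"
  by (auto simp: step_Cup_append boundary_rel_Cons)

lemma boundary_rel_Cap_append:
  "length pre = i \<Longrightarrow> boundary_rel K (Cap i # T) (pre @ x # y # post) r \<longleftrightarrow>
    y = x \<and> x \<in> carrier K \<and> boundary_rel K T (pre @ post) r"
  by (auto simp: step_Cap_append boundary_rel_Cons)

lemma boundary_rel_Cross_append:
  "length pre = i \<Longrightarrow> boundary_rel K (Cross s i # T) (pre @ x # y # post) r \<longleftrightarrow>
    x \<in> carrier K \<and> y \<in> carrier K \<and> boundary_rel K T
      (pre @ (if s then y \<star>\<^bsub>K\<^esub> x else y) # (if s then x else x \<star>\<^bsub>K\<^esub> y) # post) r"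
  by (auto simp: step_Cross_append boundary_rel_Cons)

lemmas boundary_rel_append_slice =
  boundary_rel_Cup_append boundary_rel_Cap_append boundary_rel_Cross_append

text \<open>The same rules one position further down: the strand \<open>a\<close> is absorbed into
  the prefix.\<close>

lemmas boundary_rel_append_slice_Suc =
  boundary_rel_append_slice[of "pre @ [a]" for pre a,
    simplified append_assoc append.simps length_append list.size add_0 add_Suc_right add_0_right]

section \<open>Uniqueness of the states inside short words\<close>

lemma step_two_strands:
  assumes "step K x l m" "slice_in x = 2"
  shows "\<exists>pre u v post. length pre = position x \<and> l = pre @ u # v # post"
proof -
  obtain pre a b post where *: "length pre = position x" "slice_rel K x a b" "l = pre @ a @ post"
    using assms(1) unfolding step_def by blast
  have "length a = Suc (Suc 0)" using slice_rel_length[OF *(2)] assms(2) by simp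
  then obtain u v where "a = [u, v]" by (auto simp: length_Suc_conv)
  then have "l = pre @ u # v # post" using *(3) by simp
  with *(1) show ?thesis by blast
qed

lemma step_unique:
  assumes "step K x l m" "step K x l m'" "\<And>i. x \<noteq> Cup i"
  shows "m = m'"
proof -
  have "slice_in x = 2"
    by (cases x) (simp_all add: assms(3))
  then obtain pre u v post where l: "length pre = position x" "l = pre @ u # v # post"
    using step_two_strands[OF assms(1)] by blast
  show ?thesis
  proof (cases x)
    case (Cap i)
    then show ?thesis using assms(1,2) l by (simp add: step_Cap_append)
  next
    case (Cross s i)
    then show ?thesis using assms(1,2) l by (simp add: step_Cross_append)
  next
    case (Cup i)
    then show ?thesis using assms(3)[of i] by contradiction
  qed
qed

text \<open>Read from the right, only a cap leaves a choice; a crossing can be undone because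
  translations are involutions.\<close>

lemma step_unique_back:
  assumes "kei K" "step K x l m" "step K x l' m" "\<And>i. x \<noteq> Cap i"
  shows "l = l'"
proof (cases x)
  case (Cap i)
  then show ?thesis using assms(4)[of i] by contradiction
next
  case (Cup i)
  have "step K (Cap i) m l" "step K (Cap i) m l'"
    using assms(2,3) unfolding Cup step_Cap_iff .
  then show ?thesis by (rule step_unique) simp
next
  case (Cross s i)
  then have x: "slice_in x = 2" "position x = i" by simp_all
  obtain pre u v post where l: "length pre = i" "l = pre @ u # v # post"
    using step_two_strands[OF assms(2) x(1)] unfolding x(2) by blast
  obtain pre' u' v' post' where l': "length pre' = i" "l' = pre' @ u' # v' # post'"
    using step_two_strands[OF assms(3) x(1)] unfolding x(2) by blast
  note s = assms(2)[unfolded Cross l(2) step_Cross_append[OF l(1)]]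
  note s' = assms(3)[unfolded Cross l'(2) step_Cross_append[OF l'(1)]]
  have "pre @ (if s then v \<star>\<^bsub>K\<^esub> u else v) # (if s then u else u \<star>\<^bsub>K\<^esub> v) # post =
    pre' @ (if s then v' \<star>\<^bsub>K\<^esub> u' else v') # (if s then u' else u' \<star>\<^bsub>K\<^esub> v') # post'"
    using s s' by metis
  moreover have "length pre = length pre'" using l(1) l'(1) by simp
  ultimately have eq: "pre = pre'" "post = post'"
    "(if s then v \<star>\<^bsub>K\<^esub> u else v) = (if s then v' \<star>\<^bsub>K\<^esub> u' else v')"
    "(if s then u else u \<star>\<^bsub>K\<^esub> v) = (if s then u' else u' \<star>\<^bsub>K\<^esub> v')" by simp_all
  have inj: "x = y" if "x \<star>\<^bsub>K\<^esub> z = y \<star>\<^bsub>K\<^esub> z" "x \<in> carrier K" "y \<in> carrier K" "z \<in> carrier K" for x y z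
    using that(1) kei_invol[OF assms(1) that(2,4)] kei_invol[OF assms(1) that(3,4)] by metis
  have "u = u' \<and> v = v'"
  proof (cases s)
    case True
    then have "u = u'" "v \<star>\<^bsub>K\<^esub> u = v' \<star>\<^bsub>K\<^esub> u" using eq(3,4) by simp_all
    then show ?thesis using inj[of v u v'] s s' by blast
  next
    case False
    then have "v = v'" "u \<star>\<^bsub>K\<^esub> v = u' \<star>\<^bsub>K\<^esub> v" using eq(3,4) by simp_all
    then show ?thesis using inj[of u v u'] s s' by blast
  qed
  then show ?thesis using l(2) l'(2) eq by simp
qed

text \<open>One of the two strands created by the cup survives the cap and shows the colour on the
  right: strand \<open>i\<close> if i < j, and otherwise strand i + 1, which becomes i - 1. For i =
  j a closed circle with a free colour would split off.\<close>

lemma Cup_Cap_unique: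
  assumes "i \<noteq> j" "step K (Cup i) l p" "step K (Cap j) p r" "step K (Cup i) l q" "step K (Cap j) q r"
  shows "p = q"
proof (rule nth_equalityI)
  note p = assms(2,3)[unfolded step_Cap_iff step_Cup_iff]
  note q = assms(4,5)[unfolded step_Cap_iff step_Cup_iff]
  show "length p = length q" using p q by simp
  have i: "p ! i = q ! i"
  proof (cases "i < j")
    case True
    then have "p ! i = r ! i" "q ! i = r ! i" using p q by auto
    then show ?thesis by simp
  next
    case False
    then have "j \<le> i - 1" "i - 1 < length r" "(i - 1) + 2 = i + 1" using assms(1) p by auto
    then have "p ! (i + 1) = r ! (i - 1)" "q ! (i + 1) = r ! (i - 1)" using p q by metis+
    moreover have "p ! i = p ! (i + 1)" "q ! i = q ! (i + 1)" using p q by blast+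
    ultimately show ?thesis by simp
  qed
  fix k assume k: "k < length p"
  show "p ! k = q ! k"
  proof (cases "i + 2 \<le> k")
    case True
    then have *: "k - 2 + 2 = k" "i \<le> k - 2" "k - 2 < length l" using p k by auto
    then have "p ! (k - 2 + 2) = l ! (k - 2)" "q ! (k - 2 + 2) = l ! (k - 2)" using p q by blast+
    then show ?thesis using *(1) by simp
  next
    case False
    then consider "k < i" | "k = i" | "k = i + 1" by linarith
    then show ?thesis
    proof cases
      case 1
      then have "p ! k = l ! k" "q ! k = l ! k" using p q by blast+
      then show ?thesis by simp
    next
      case 3
      have "p ! i = p ! (i + 1)" "q ! i = q ! (i + 1)" using p q by blast+
      then show ?thesis using i 3 by simp
    qed (use i in simp)
  qed
qed

text \<open>The middle state is determined from the left unless \<open>x\<close> is a cup, and from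
  the right unless \<open>y\<close> is a cap; when both happen, \<open>Cup_Cap_unique\<close>
  applies.\<close>

lemma boundary_determined_pair:
  assumes "kei K"
    and "\<And>i j. x = Cup i \<Longrightarrow> y = Cap j \<Longrightarrow> i \<noteq> j"
  shows "boundary_determined K m [x, y]"
proof -
  have "p = q" if "step K x l p" "step K y p r" "step K x l q" "step K y q r" for l p q r
  proof (cases "(\<exists>i. x = Cup i) \<and> (\<exists>j. y = Cap j)")
    case True
    then obtain i j where x: "x = Cup i" "y = Cap j" by blast
    show ?thesis by (rule Cup_Cap_unique[OF assms(2)[OF x] that[unfolded x]])
  next
    case False
    then consider "\<And>i. x \<noteq> Cup i" | "\<And>j. y \<noteq> Cap j" by blast
    then show ?thesis
    proof cases
      case 1
      show ?thesis by (rule step_unique[OF that(1,3) 1])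
    next
      case 2
      show ?thesis by (rule step_unique_back[OF assms(1) that(2,4) 2])
    qed
  qed
  then show ?thesis unfolding boundary_determined_def by auto
qed

lemma boundary_determined_short: "boundary_determined K m []" "boundary_determined K m [x]"
  by (auto simp: boundary_determined_def)

lemma trace_unique:
  "\<forall>x\<in>set T. \<forall>i. x \<noteq> Cup i \<Longrightarrow> trace K T l ss r \<Longrightarrow> trace K T l ss' r' \<Longrightarrow> ss = ss' \<and> r = r'"
proof (induction T arbitrary: l ss ss')
  case (Cons x T)
  obtain m ss1 where 1: "ss = m # ss1" "step K x l m" "trace K T m ss1 r"
    using Cons.prems(2) by auto
  obtain m' ss2 where 2: "ss' = m' # ss2" "step K x l m'" "trace K T m' ss2 r'"
    using Cons.prems(3) by auto
  have "m = m'" using step_unique[OF 1(2) 2(2)] Cons.prems(1) by simp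
  then show ?case using Cons.IH[of m ss1 ss2] Cons.prems(1) 1 2 by simp
qed simp

lemma boundary_determined_no_Cup:
  "\<forall>x\<in>set T. \<forall>i. x \<noteq> Cup i \<Longrightarrow> boundary_determined K m T"
  unfolding boundary_determined_def by (intro allI impI) (rule trace_unique[THEN conjunct1])

lemma slice_shift [simp]:
  "slice_rel K (shift_slice d x) = slice_rel K x" "position (shift_slice d x) = position x + d"
  by (cases x; simp add: fun_eq_iff)+

text \<open>Both orders amount to cutting the state around \<open>x\<close> and \<open>y\<close> at
  once, a description in which the order has disappeared.\<close>

lemma exchange_boundary_rel:
  assumes "position x \<le> position y"
  shows "boundary_rel K [x, shift_slice (slice_out x) y] l r \<longleftrightarrow>
      (\<exists>pre a b mid c d post. length pre = position x \<and> length (pre @ mid) = position y \<and>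
        slice_rel K x a b \<and> slice_rel K y c d \<and>
        l = pre @ a @ mid @ c @ post \<and> r = pre @ b @ mid @ d @ post)" (is "?A \<longleftrightarrow> ?C")
    and "boundary_rel K [shift_slice (slice_in x) y, x] l r \<longleftrightarrow>
      (\<exists>pre a b mid c d post. length pre = position x \<and> length (pre @ mid) = position y \<and>
        slice_rel K x a b \<and> slice_rel K y c d \<and>
        l = pre @ a @ mid @ c @ post \<and> r = pre @ b @ mid @ d @ post)" (is "?B \<longleftrightarrow> ?C")
proof -
  \<comment> \<open>Two cuts of one list: if the second prefix is long enough, it contains
    everything that the upper slice touches.\<close>
  have split: "\<exists>mid. pre' = pre @ a @ mid \<and> post = mid @ post'"
    if "pre @ a @ post = pre' @ post'" "length (pre @ a) \<le> length pre'" for pre a post pre' post' :: "'a list"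
  proof -
    have "(pre @ a) @ post = pre' @ post'" using that(1) by simp
    then obtain us where "pre @ a = pre' @ us \<and> us @ post = post' \<or> (pre @ a) @ us = pre' \<and> post = us @ post'"
      unfolding append_eq_append_conv2[of "pre @ a"] by blast
    then show ?thesis
    proof
      assume us: "pre @ a = pre' @ us \<and> us @ post = post'"
      then have "length (pre @ a) = length pre' + length us" by (metis length_append)
      then have "us = []" using that(2) by simp
      then show ?thesis using us by (intro exI[of _ "[]"]) simp
    next
      assume "(pre @ a) @ us = pre' \<and> post = us @ post'"
      then show ?thesis by (intro exI[of _ us]) auto
    qed
  qed
  show "?A \<longleftrightarrow> ?C"
  proof
    assume ?A
    then obtain pre a b post pre' c d post' where x: "length pre = position x" "slice_rel K x a b"
        "l = pre @ a @ post"
      and y: "length pre' = position y + slice_out x" "slice_rel K y c d"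
        "pre @ b @ post = pre' @ c @ post'" "r = pre' @ d @ post'"
      by (auto simp: step_def boundary_rel_Cons)
    obtain mid where mid: "pre' = pre @ b @ mid" "post = mid @ c @ post'"
      using split[OF y(3)] x y(1) slice_rel_length[OF x(2)] assms by auto
    then have "length (pre @ mid) = position y" using y(1) slice_rel_length[OF x(2)] by simp
    then show ?C using x y mid by (metis append.assoc)
  next
    assume ?C
    then obtain pre a b mid c d post where *: "length pre = position x" "length (pre @ mid) = position y"
      "slice_rel K x a b" "slice_rel K y c d" "l = pre @ a @ mid @ c @ post" "r = pre @ b @ mid @ d @ post"
      by blast
    have "step K x l (pre @ b @ mid @ c @ post)"
      unfolding step_def using * by blast
    moreover have "step K (shift_slice (slice_out x) y) ((pre @ b @ mid) @ c @ post) ((pre @ b @ mid) @ d @ post)"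
      unfolding step_def slice_shift using * slice_rel_length[OF *(3)]
      by (intro exI[of _ "pre @ b @ mid"] exI[of _ c] exI[of _ d] exI[of _ post]) simp
    ultimately show ?A using * by (auto simp: boundary_rel_Cons)
  qed
  show "?B \<longleftrightarrow> ?C"
  proof
    assume ?B
    then obtain p where p: "step K (shift_slice (slice_in x) y) l p" "step K x p r" by (auto simp: boundary_rel_Cons)
    then obtain pre a b post pre' c d post' where x: "length pre = position x" "slice_rel K x a b"
        "pre @ a @ post = pre' @ d @ post'" "r = pre @ b @ post"
      and y: "length pre' = position y + slice_in x" "slice_rel K y c d"
        "l = pre' @ c @ post'"
      unfolding step_def slice_shift by metis
    obtain mid where mid: "pre' = pre @ a @ mid" "post = mid @ d @ post'"
      using split[OF x(3)] x y(1) slice_rel_length[OF x(2)] assms by auto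
    then have "length (pre @ mid) = position y" using y(1) slice_rel_length[OF x(2)] by simp
    then show ?C using x y mid by (metis append.assoc)
  next
    assume ?C
    then obtain pre a b mid c d post where *: "length pre = position x" "length (pre @ mid) = position y"
      "slice_rel K x a b" "slice_rel K y c d" "l = pre @ a @ mid @ c @ post" "r = pre @ b @ mid @ d @ post"
      by blast
    have "step K x (pre @ a @ mid @ d @ post) r"
      unfolding step_def using * by blast
    moreover have "step K (shift_slice (slice_in x) y) ((pre @ a @ mid) @ c @ post) ((pre @ a @ mid) @ d @ post)"
      unfolding step_def slice_shift using * slice_rel_length[OF *(3)]
      by (intro exI[of _ "pre @ a @ mid"] exI[of _ c] exI[of _ d] exI[of _ post]) simp
    ultimately show ?B using * by (auto simp: boundary_rel_Cons)
  qed
qed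

lemma exchangeableI:
  assumes "boundary_determined K m S" "boundary_determined K m T"
    and "\<And>l r. length l = m \<Longrightarrow> set l \<subseteq> carrier K \<Longrightarrow> boundary_rel K S l r = boundary_rel K T l r"
  shows "exchangeable K m S T"
  using assms by (simp add: exchangeable_def)

lemma list_split:
  assumes "i + d \<le> length l"
  obtains pre mid post where "l = pre @ mid @ post" "length pre = i" "length mid = d"
  using that[of "take i l" "take d (drop i l)" "drop d (drop i l)"] assms
  by (simp del: drop_drop)

lemma local_move_exchangeable:
  assumes K: "kei K" and "local_move S T" "tangle m S k" "tangle m T k'"
  shows "exchangeable K m S T"
  using assms(2-4)
proof cases
  case (exchange x y)
  show ?thesis unfolding exchange(1,2)
  proof (rule exchangeableI)
    \<comment> \<open>The only critical pair is a cup followed by a cap; the shift by two keeps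
      their positions distinct.\<close>
    show "boundary_determined K m [x, shift_slice (slice_out x) y]"
      "boundary_determined K m [shift_slice (slice_in x) y, x]"
      using exchange(3) by (intro boundary_determined_pair[OF K]; cases x; cases y; auto)+
  qed (simp only: exchange_boundary_rel[OF exchange(3)])
next
  case (zigzag_up i)
  show ?thesis unfolding zigzag_up
  proof (rule exchangeableI)
    fix l r :: "'a list" assume l: "length l = m" "set l \<subseteq> carrier K"
    have "i + 1 \<le> length l" using assms(3) l by (simp add: zigzag_up)
    then obtain pre mid post where "l = pre @ mid @ post" "length pre = i" "length mid = 1"
      by (rule list_split)
    then show "boundary_rel K [Cup i, Cap (i + 1)] l r = boundary_rel K [] l r"
      using l(2) by (auto simp: length_Suc_conv boundary_rel_append_slice boundary_rel_append_slice_Suc)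
  qed (auto intro!: boundary_determined_pair[OF K] boundary_determined_short)
next
  case (zigzag_down i)
  show ?thesis unfolding zigzag_down
  proof (rule exchangeableI)
    fix l r :: "'a list" assume l: "length l = m" "set l \<subseteq> carrier K"
    have "i + 1 \<le> length l" using assms(3) l by (simp add: zigzag_down)
    then obtain pre mid post where "l = pre @ mid @ post" "length pre = i" "length mid = 1"
      by (rule list_split)
    then show "boundary_rel K [Cup (i + 1), Cap i] l r = boundary_rel K [] l r"
      using l(2) by (auto simp: length_Suc_conv boundary_rel_append_slice boundary_rel_append_slice_Suc)
  qed (auto intro!: boundary_determined_pair[OF K] boundary_determined_short)
next
  case (slide_cap s i)
  show ?thesis unfolding slide_cap
  proof (rule exchangeableI)
    fix l r :: "'a list" assume l: "length l = m" "set l \<subseteq> carrier K"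
    have "i + 3 \<le> length l" using assms(3) l by (simp add: slide_cap)
    then obtain pre mid post where "l = pre @ mid @ post" "length pre = i" "length mid = 3"
      by (rule list_split)
    then obtain a b c where abc: "l = pre @ a # b # c # post" "length pre = i"
      "a \<in> carrier K" "b \<in> carrier K" "c \<in> carrier K"
      using l(2) by (auto simp: length_Suc_conv numeral_2_eq_2 numeral_3_eq_3)
    have "c = b \<star>\<^bsub>K\<^esub> a \<longleftrightarrow> c \<star>\<^bsub>K\<^esub> a = b" if "a \<in> carrier K" "b \<in> carrier K" "c \<in> carrier K" for a b c
      using kei_invol[OF K] that by metis
    then show "boundary_rel K [Cross s i, Cap (i + 1)] l r = boundary_rel K [Cross (\<not> s) (i + 1), Cap i] l r"
      using abc(2-) unfolding abc(1)
      by (cases s) (auto simp: boundary_rel_append_slice boundary_rel_append_slice_Suc kei_simps[OF K])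
  qed (auto intro!: boundary_determined_pair[OF K])
next
  case (slide_cup i s)
  show ?thesis unfolding slide_cup
  proof (rule exchangeableI)
    fix l r :: "'a list" assume l: "length l = m" "set l \<subseteq> carrier K"
    have "i + 1 \<le> length l" using assms(3) l by (simp add: slide_cup)
    then obtain pre mid post where "l = pre @ mid @ post" "length pre = i" "length mid = 1"
      by (rule list_split)
    then obtain y where y: "l = pre @ y # post" "length pre = i" "y \<in> carrier K"
      using l(2) by (auto simp: length_Suc_conv)
    \<comment> \<open>The colour created by the cup is x in one word and x * y in the other;
      translation by y, an involution, matches the choices.\<close>
    have "(\<exists>x\<in>carrier K. r = pre @ x # y # (x \<star>\<^bsub>K\<^esub> y) # post) \<longleftrightarrow>
        (\<exists>x\<in>carrier K. r = pre @ (x \<star>\<^bsub>K\<^esub> y) # y # x # post)"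
      using kei_invol[OF K _ y(3)] kei_closed[OF K _ y(3)] by metis
    then show "boundary_rel K [Cup i, Cross s (i + 1)] l r =
        boundary_rel K [Cup (i + 1), Cross (\<not> s) i] l r"
      using y(2,3) unfolding y(1)
      by (cases s) (simp_all add: boundary_rel_append_slice boundary_rel_append_slice_Suc)
  qed (auto intro!: boundary_determined_pair[OF K])
next
  case (reidemeister1_cap s i)
  show ?thesis unfolding reidemeister1_cap
  proof (rule exchangeableI)
    fix l r :: "'a list" assume l: "length l = m" "set l \<subseteq> carrier K"
    have "i + 2 \<le> length l" using assms(3) l by (simp add: reidemeister1_cap)
    then obtain pre mid post where "l = pre @ mid @ post" "length pre = i" "length mid = 2"
      by (rule list_split)
    then obtain a b where abc: "l = pre @ a # b # post" "length pre = i"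
      "a \<in> carrier K" "b \<in> carrier K"
      using l(2) by (auto simp: length_Suc_conv numeral_2_eq_2 numeral_3_eq_3)
    \<comment> \<open>Translation by y is injective and fixes y.\<close>
    have "x \<star>\<^bsub>K\<^esub> y = y \<longleftrightarrow> x = y" "y = x \<star>\<^bsub>K\<^esub> y \<longleftrightarrow> x = y"
      if "x \<in> carrier K" "y \<in> carrier K" for x y
      using kei_idem[OF K] kei_invol[OF K] that by metis+
    then show "boundary_rel K [Cross s i, Cap i] l r = boundary_rel K [Cap i] l r"
      using abc(2-) unfolding abc(1)
      by (cases s) (auto simp: boundary_rel_append_slice boundary_rel_append_slice_Suc kei_simps[OF K])
  qed (auto intro!: boundary_determined_pair[OF K] boundary_determined_short)
next
  case (reidemeister1_cup i s)
  show ?thesis unfolding reidemeister1_cup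
  proof (rule exchangeableI)
    fix l r :: "'a list" assume l: "length l = m" "set l \<subseteq> carrier K"
    have "i + 0 \<le> length l" using assms(3) l by (simp add: reidemeister1_cup)
    then obtain pre mid post where "l = pre @ mid @ post" "length pre = i" "length mid = 0"
      by (rule list_split)
    then show "boundary_rel K [Cup i, Cross s i] l r = boundary_rel K [Cup i] l r"
      using l(2) by (auto simp: kei_simps[OF K] boundary_rel_append_slice boundary_rel_append_slice_Suc)
  qed (auto intro!: boundary_determined_pair[OF K] boundary_determined_short)
next
  case (reidemeister2 s i)
  show ?thesis unfolding reidemeister2
  proof (rule exchangeableI)
    fix l r :: "'a list" assume l: "length l = m" "set l \<subseteq> carrier K"
    have "i + 2 \<le> length l" using assms(3) l by (simp add: reidemeister2)
    then obtain pre mid post where "l = pre @ mid @ post" "length pre = i" "length mid = 2"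
      by (rule list_split)
    then obtain a b where abc: "l = pre @ a # b # post" "length pre = i"
      "a \<in> carrier K" "b \<in> carrier K"
      using l(2) by (auto simp: length_Suc_conv numeral_2_eq_2 numeral_3_eq_3)
    show "boundary_rel K [Cross s i, Cross (\<not> s) i] l r = boundary_rel K [] l r"
      using abc(2-) unfolding abc(1)
      by (cases s) (auto simp: boundary_rel_append_slice boundary_rel_append_slice_Suc kei_simps[OF K])
  qed (auto intro!: boundary_determined_pair[OF K] boundary_determined_short)
next
  case (reidemeister3 t s u i)
  show ?thesis unfolding reidemeister3(1,2)
  proof (rule exchangeableI)
    fix l r :: "'a list" assume l: "length l = m" "set l \<subseteq> carrier K"
    have "i + 3 \<le> length l" using assms(3) l by (simp add: reidemeister3)
    then obtain pre mid post where "l = pre @ mid @ post" "length pre = i" "length mid = 3"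
      by (rule list_split)
    then obtain a b c where abc: "l = pre @ a # b # c # post" "length pre = i"
      "a \<in> carrier K" "b \<in> carrier K" "c \<in> carrier K"
      using l(2) by (auto simp: length_Suc_conv numeral_3_eq_3)
    show "boundary_rel K [Cross s i, Cross t (i + 1), Cross u i] l r =
        boundary_rel K [Cross u (i + 1), Cross t i, Cross s (i + 1)] l r"
      \<comment> \<open>Six of the eight sign patterns meet the side condition, and for them
        self-distributivity in the forms of \<open>kei_simps\<close> makes both sides agree.\<close>
      using reidemeister3(3) abc(2-) unfolding abc(1)
      by (cases s; cases t; cases u) (simp_all add: boundary_rel_append_slice boundary_rel_append_slice_Suc kei_simps[OF K])
  qed (auto intro!: boundary_determined_no_Cup)
qed

lemma isotopy_step_burnside_kei:
  assumes "isotopy_step D D'"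
  shows "burnside_kei n D \<cong>\<^sub>K burnside_kei n D' \<and> burnside_kei n D' \<cong>\<^sub>K burnside_kei n D"
proof -
  obtain A S T B where D: "link_diagram D" "link_diagram D'"
    and eq: "D = A @ S @ B" "D' = A @ T @ B" and move: "local_move S T"
    using assms unfolding isotopy_step_def by blast
  obtain m k where A: "tangle 0 A m" "tangle m S k"
    using D(1) by (auto simp: eq link_diagram_def tangle_append)
  obtain m' k' where "tangle 0 A m'" "tangle m' T k'"
    using D(2) by (auto simp: eq link_diagram_def tangle_append)
  then have T: "tangle m T k'" using A(1) tangle_width by blast
  have "exchangeable K m S T" if "burnside_law n K" for K :: "(nat \<times> nat) set kei_term set set set binary_structure"
    by (rule local_move_exchangeable[OF _ move A(2) T]) (use that in \<open>simp add: burnside_law_def\<close>)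
  note ex = this exchangeable_sym[OF this]
  show ?thesis
    unfolding eq
    by (intro conjI burnside_kei_exchange[OF A(1)] D[unfolded eq] ex)
qed

lemma isotopic_burnside_kei:
  assumes "isotopic D D'"
  shows "burnside_kei n D \<cong>\<^sub>K burnside_kei n D'"
  using assms unfolding isotopic_def
proof (induction rule: equivclp_induct)
  case base
  show ?case by (rule kei_isomorphic_refl)
next
  case (step D' D'')
  then show ?case
    using isotopy_step_burnside_kei kei_isomorphic_trans by blast
qed

section \<open>Colourings of rational tangles\<close>

text \<open>
  The homomorphisms from the free Kei on two generators, realised as the integers with
  \<open>i * j = 2j - i\<close>.
\<close>

definition dihedral :: "('a, 'm) binary_structure_scheme \<Rightarrow> (int \<Rightarrow> 'a) \<Rightarrow> bool" where
  "dihedral K \<psi> \<longleftrightarrow> (\<forall>t. \<psi> t \<in> carrier K) \<and> (\<forall>s t. \<psi> s \<star>\<^bsub>K\<^esub> \<psi> t = \<psi> (2 * t - s))"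

lemma dihedral_affine: "dihedral K \<psi> \<Longrightarrow> dihedral K (\<lambda>t. \<psi> (a + e * t))"
  by (simp add: dihedral_def algebra_simps)

fun dihedral_seq :: "('a, 'm) binary_structure_scheme \<Rightarrow> 'a \<Rightarrow> 'a \<Rightarrow> nat \<Rightarrow> 'a" where
  "dihedral_seq K a b 0 = a"
| "dihedral_seq K a b (Suc 0) = b"
| "dihedral_seq K a b (Suc (Suc k)) = dihedral_seq K a b k \<star>\<^bsub>K\<^esub> dihedral_seq K a b (Suc k)"

lemma dihedral_seq_closed:
  "kei K \<Longrightarrow> a \<in> carrier K \<Longrightarrow> b \<in> carrier K \<Longrightarrow> dihedral_seq K a b k \<in> carrier K"
  by (induction K a b k rule: dihedral_seq.induct) (simp_all add: kei_closed)

text \<open>Reflecting neighbours suffices. Position t + d + 2 is the reflection of t + d in t + d +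
  1, and reflection in \<psi> t is an automorphism, so the claim for distance d + 2 follows from
  those for d and d + 1. Positions to the left of t follow by involutivity.\<close>

lemma dihedralI:
  assumes K: "kei K" and closed: "\<And>t. \<psi> t \<in> carrier K"
    and rel: "\<And>t. \<psi> (t + 1) \<star>\<^bsub>K\<^esub> \<psi> t = \<psi> (t - 1)"
  shows "dihedral K \<psi>"
proof -
  have pos: "\<psi> (t + int d) \<star>\<^bsub>K\<^esub> \<psi> t = \<psi> (t - int d)" for t d
  proof (induction d rule: induct_nat_012)
    case 0
    show ?case using kei_idem[OF K closed] by simp
  next
    case 1
    show ?case using rel by simp
  next
    case (ge2 d)
    have "\<psi> (t + int d) = \<psi> (t + int (Suc (Suc d))) \<star>\<^bsub>K\<^esub> \<psi> (t + int (Suc d))"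
      using rel[of "t + int (Suc d)"] by (simp add: algebra_simps)
    then have "\<psi> (t + int (Suc (Suc d))) = \<psi> (t + int d) \<star>\<^bsub>K\<^esub> \<psi> (t + int (Suc d))"
      using kei_invol[OF K closed closed] by simp
    then have "\<psi> (t + int (Suc (Suc d))) \<star>\<^bsub>K\<^esub> \<psi> t = \<psi> (t - int d) \<star>\<^bsub>K\<^esub> \<psi> (t - int (Suc d))"
      using kei_distrib[OF K closed closed closed] ge2 by metis
    also have "\<dots> = \<psi> (t - int (Suc (Suc d)))"
      using rel[of "t - int (Suc d)"] by (simp add: algebra_simps)
    finally show ?case .
  qed
  have "\<psi> s \<star>\<^bsub>K\<^esub> \<psi> t = \<psi> (2 * t - s)" for s t
  proof (cases "t \<le> s")
    case True
    then show ?thesis using pos[of t "nat (s - t)"] by (simp add: algebra_simps)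
  next
    case False
    then have "\<psi> (2 * t - s) \<star>\<^bsub>K\<^esub> \<psi> t = \<psi> s"
      using pos[of t "nat (t - s)"] by (simp add: algebra_simps)
    then show ?thesis using kei_invol[OF K closed closed] by metis
  qed
  with closed show ?thesis by (simp add: dihedral_def)
qed

text \<open>The existence half of the universal property of the integers as the free Kei on 0 and
  1.\<close>

lemma dihedral_exists:
  assumes K: "kei K" and a: "a \<in> carrier K" and b: "b \<in> carrier K"
  shows "\<exists>\<psi>. dihedral K \<psi> \<and> \<psi> 0 = a \<and> \<psi> 1 = b"
proof -
  \<comment> \<open>The rule i * j = 2j - i forces the value b * a at -1; the negative half is the
    sequence that starts with a and b * a.\<close>
  define \<psi> where "\<psi> t = (if t \<ge> 0 then dihedral_seq K a b (nat t)
    else dihedral_seq K a (b \<star>\<^bsub>K\<^esub> a) (nat (- t)))" for t :: int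
  have closed: "\<psi> t \<in> carrier K" for t
    using dihedral_seq_closed[OF K a] b kei_closed[OF K b a] by (simp add: \<psi>_def)
  have pos: "\<psi> (int k) = dihedral_seq K a b k" for k by (simp add: \<psi>_def)
  have neg: "\<psi> (- int k) = dihedral_seq K a (b \<star>\<^bsub>K\<^esub> a) k" for k
    by (cases k) (simp_all add: \<psi>_def nat_add_distrib)
  have "\<psi> (t + 1) \<star>\<^bsub>K\<^esub> \<psi> t = \<psi> (t - 1)" for t
  proof -
    consider "t = 0" | k where "t = int (Suc k)" | k where "t = - int (Suc k)"
      by (metis int_cases2 not0_implies_Suc of_nat_0 neg_0_equal_iff_equal)
    then show ?thesis
    proof cases
      case 1
      then show ?thesis using pos[of 1] pos[of 0] neg[of 1] by simp
    next
      case (2 k)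
      then have "t + 1 = int (Suc (Suc k))" "t - 1 = int k" by simp_all
      then have "\<psi> (t + 1) = \<psi> (t - 1) \<star>\<^bsub>K\<^esub> \<psi> t"
        using 2 pos[of k] pos[of "Suc k"] pos[of "Suc (Suc k)"] by (simp only: dihedral_seq.simps)
      then show ?thesis using kei_invol[OF K closed closed] by simp
    next
      case (3 k)
      then have "t + 1 = - int k" "t - 1 = - int (Suc (Suc k))" by simp_all
      then show ?thesis
        using 3 neg[of k] neg[of "Suc k"] neg[of "Suc (Suc k)"] by (simp only: dihedral_seq.simps)
    qed
  qed
  then have "dihedral K \<psi>" by (intro dihedralI K closed)
  moreover have "\<psi> 0 = a" "\<psi> 1 = b" by (simp_all add: \<psi>_def)
  ultimately show ?thesis by blast
qed

text \<open>The inner word of the recursion starts at s + e and runs in the opposite direction, with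
  step -e; the final product with \<psi> (s + e) reflects its value back to the right side.\<close>

lemma alternating_dihedral:
  assumes "dihedral K \<psi>"
  shows "alternating K n (\<psi> s) (\<psi> (s + e)) = \<psi> (s + int n * e)"
proof (induction n arbitrary: s e rule: less_induct)
  case (less n)
  consider "n = 0" | "n = Suc 0" | m where "n = Suc (Suc m)"
    by (metis not0_implies_Suc)
  then show ?case
  proof cases
    case (3 m)
    have "alternating K (Suc m) (\<psi> (s + e)) (\<psi> (s + e + - e)) = \<psi> (s + e + int (Suc m) * - e)"
      using less 3 by blast
    then show ?thesis using 3 assms by (simp add: dihedral_def algebra_simps)
  qed simp_all
qed

lemma dihedral_periodic:
  assumes law: "burnside_law n K" and \<psi>: "dihedral K \<psi>"
  shows "\<psi> (t + k * int n) = \<psi> t"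
proof -
  have per: "\<psi> (t + int n) = \<psi> t" for t
    using alternating_dihedral[OF \<psi>, of n t 1] law \<psi> by (simp add: burnside_law_def dihedral_def)
  show ?thesis
  proof (induction k rule: int_induct[of _ 0])
    case (step1 i)
    then show ?case using per[of "t + i * int n"] by (simp add: algebra_simps)
  next
    case (step2 i)
    then show ?case using per[of "t + (i - 1) * int n"] by (simp add: algebra_simps)
  qed simp
qed

lemma dihedral_with_values:
  assumes law: "burnside_law n K" and "coprime (int n) q" "a \<in> carrier K" "b \<in> carrier K"
  shows "\<exists>\<psi>. dihedral K \<psi> \<and> \<psi> 0 = a \<and> \<psi> q = b"
proof -
  obtain \<chi> where \<chi>: "dihedral K \<chi>" "\<chi> 0 = a" "\<chi> 1 = b"
    using dihedral_exists assms by (metis burnside_law_def)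
  obtain u v where "u * int n + v * q = 1"
    using assms(2) bezout_int[of "int n" q] by (auto simp: coprime_iff_gcd_eq_1)
  \<comment> \<open>Modulo n, v inverts q; so the rescaled map that sends t to \<chi> (v * t) takes
    the value \<chi> 1 at q.\<close>
  then have "v * q = 1 + (- u) * int n" by simp
  then have "\<chi> (v * q) = b" using dihedral_periodic[OF law \<chi>(1), of 1 "- u"] \<chi>(3) by metis
  then show ?thesis
    using dihedral_affine[OF \<chi>(1), of 0 v] \<chi>(2) by (intro exI[of _ "\<lambda>t. \<chi> (v * t)"]) simp
qed

section \<open>Colourings of twists\<close>

lemma boundary_rel_Cross_pair:
  "boundary_rel K (Cross s 0 # T) [x, y] r \<longleftrightarrow> x \<in> carrier K \<and> y \<in> carrier K \<and> boundary_rel K T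
    [if s then y \<star>\<^bsub>K\<^esub> x else y, if s then x else x \<star>\<^bsub>K\<^esub> y] r"
  using boundary_rel_Cross_append[of "[]" 0 K s T x y "[]" r] by simp

lemma twist_forward:
  assumes "dihedral K \<psi>"
  shows "boundary_rel K (integer_tangle k) [\<psi> s, \<psi> (s + e)] r \<longleftrightarrow>
    r = [\<psi> (s - k * e), \<psi> (s - k * e + e)]"
proof -
  have "boundary_rel K (replicate j (Cross b 0)) [\<psi> s, \<psi> (s + e)] r \<longleftrightarrow>
    r = [\<psi> (s - (if b then int j else - int j) * e), \<psi> (s - (if b then int j else - int j) * e + e)]" for j b
  proof (induction j arbitrary: s)
    case (Suc j)
    have "[if b then \<psi> (s + e) \<star>\<^bsub>K\<^esub> \<psi> s else \<psi> (s + e), if b then \<psi> s else \<psi> s \<star>\<^bsub>K\<^esub> \<psi> (s + e)] =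
        [\<psi> (s - (if b then e else - e)), \<psi> (s - (if b then e else - e) + e)]"
      using assms by (simp add: dihedral_def algebra_simps)
    then show ?case
      using Suc[of "s - (if b then e else - e)"] assms
      by (cases b) (simp_all add: boundary_rel_Cross_pair dihedral_def algebra_simps)
  qed simp
  from this[of "nat \<bar>k\<bar>" "k > 0"] show ?thesis
    by (cases "k > 0") (simp_all add: integer_tangle_def)
qed

text \<open>Complements \<open>twist_forward\<close> where the homomorphism is known only to the
  right of the twists: in the induction on continued fractions it comes from the rotated tail, and
  the colours on the left still have to be located on it.\<close>

lemma twist_backward:
  assumes K: "kei K" and \<psi>: "dihedral K \<psi>"
    and rel: "boundary_rel K (integer_tangle k) [x, y] [\<psi> s, \<psi> (s + e)]"
  shows "x = \<psi> (s + k * e) \<and> y = \<psi> (s + k * e + e)"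
proof -
  have "x = \<psi> (s + (if b then int j else - int j) * e) \<and> y = \<psi> (s + (if b then int j else - int j) * e + e)"
    if "boundary_rel K (replicate j (Cross b 0)) [x, y] [\<psi> s, \<psi> (s + e)]" for j b
    using that
  proof (induction j arbitrary: x y)
    case (Suc j)
    let ?t = "s + (if b then int j else - int j) * e"
    have xy: "x \<in> carrier K" "y \<in> carrier K"
      and "(if b then y \<star>\<^bsub>K\<^esub> x else y) = \<psi> ?t" "(if b then x else x \<star>\<^bsub>K\<^esub> y) = \<psi> (?t + e)"
      using Suc by (auto simp: boundary_rel_Cross_pair simp del: if_split)
    note * = this
    show ?case
    proof (cases b)
      case True
      then have "y = \<psi> ?t \<star>\<^bsub>K\<^esub> \<psi> (?t + e)" "x = \<psi> (?t + e)"
        using * kei_invol[OF K xy(2,1)] by simp_all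
      then show ?thesis using True \<psi> by (simp add: dihedral_def algebra_simps)
    next
      case False
      then have "x = \<psi> (?t + e) \<star>\<^bsub>K\<^esub> \<psi> ?t" "y = \<psi> ?t"
        using * kei_invol[OF K xy] by simp_all
      then show ?thesis using False \<psi> by (simp add: dihedral_def algebra_simps)
    qed
  qed simp
  from this[of "nat \<bar>k\<bar>" "k > 0"] rel show ?thesis
    by (cases "k > 0") (simp_all add: integer_tangle_def)
qed

section \<open>Tangles among further strands, and rotation\<close>

lemma slice_fits_iff: "slice_fits x m \<longleftrightarrow> position x + slice_in x \<le> m"
  by (cases x) auto

lemma step_shift:
  assumes fits: "slice_fits x (length l)" and pre: "length pre = d"
  shows "step K (shift_slice d x) (pre @ l @ post) m \<longleftrightarrow> (\<exists>m0. m = pre @ m0 @ post \<and> step K x l m0)"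
proof -
  let ?p = "take (position x) l" and ?s = "drop (position x) l"
  have len: "length ?p = position x" using fits by (simp add: slice_fits_iff)
  have "step K (shift_slice d x) ((pre @ ?p) @ ?s @ post) m \<longleftrightarrow>
      (\<exists>a b c. slice_rel K x a b \<and> ?s @ post = a @ c \<and> m = (pre @ ?p) @ b @ c)"
    using step_append_iff[of "pre @ ?p" "shift_slice d x" K "?s @ post" m] len pre by simp
  also have "\<dots> \<longleftrightarrow> (\<exists>a b c. slice_rel K x a b \<and> ?s = a @ c \<and> m = pre @ (?p @ b @ c) @ post)"
  proof
    assume "\<exists>a b c. slice_rel K x a b \<and> ?s @ post = a @ c \<and> m = (pre @ ?p) @ b @ c"
    then obtain a b c where *: "slice_rel K x a b" "?s @ post = a @ c" "m = (pre @ ?p) @ b @ c" by blast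
    \<comment> \<open>The slice fits into \<open>l\<close>, so the strands that it touches end
      before \<open>post\<close>.\<close>
    have "length a \<le> length ?s"
      using slice_rel_length[OF *(1)] fits by (auto simp: slice_fits_iff)
    then obtain c' where "?s = a @ c'"
      using arg_cong[OF *(2), of "take (length a)"] by (metis append_eq_conv_conj append_take_drop_id
          take_append diff_is_0_eq take0 append_Nil2)
    then show "\<exists>a b c. slice_rel K x a b \<and> ?s = a @ c \<and> m = pre @ (?p @ b @ c) @ post"
      using * by auto
  next
    assume "\<exists>a b c. slice_rel K x a b \<and> ?s = a @ c \<and> m = pre @ (?p @ b @ c) @ post"
    then obtain a b c where *: "slice_rel K x a b" "?s = a @ c" "m = pre @ (?p @ b @ c) @ post" by blast
    then show "\<exists>a b c. slice_rel K x a b \<and> ?s @ post = a @ c \<and> m = (pre @ ?p) @ b @ c"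
      by (intro exI[of _ a] exI[of _ b] exI[of _ "c @ post"]) simp
  qed
  also have "\<dots> \<longleftrightarrow> (\<exists>m0. m = pre @ m0 @ post \<and> step K x (?p @ ?s) m0)"
    unfolding step_append_iff[OF len] by blast
  finally show ?thesis by (simp only: append_assoc[symmetric] append_take_drop_id)
    (simp only: append_assoc append_take_drop_id)
qed

lemma trace_shift:
  assumes "tangle (length l) T k" "length pre = d"
  shows "trace K (shift d T) (pre @ l @ post) ss r \<longleftrightarrow>
    (\<exists>ss0 r0. ss = map (\<lambda>s. pre @ s @ post) ss0 \<and> r = pre @ r0 @ post \<and> trace K T l ss0 r0)"
  using assms(1)
proof (induction T arbitrary: l ss)
  case Nil
  show ?case by (auto simp: shift_def)
next
  case (Cons x T)
  have fits: "slice_fits x (length l)" using Cons.prems by simp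
  have IH: "trace K (shift d T) (pre @ m0 @ post) ss' r \<longleftrightarrow>
      (\<exists>ss0 r0. ss' = map (\<lambda>s. pre @ s @ post) ss0 \<and> r = pre @ r0 @ post \<and> trace K T m0 ss0 r0)"
    if "step K x l m0" for m0 ss'
    using Cons.IH[of m0 ss'] Cons.prems step_fits[OF that] by simp
  have "trace K (shift d (x # T)) (pre @ l @ post) ss r \<longleftrightarrow>
      (\<exists>m0 ss'. ss = (pre @ m0 @ post) # ss' \<and> step K x l m0 \<and> trace K (shift d T) (pre @ m0 @ post) ss' r)"
    by (auto simp: shift_def step_shift[OF fits assms(2)])
  also have "\<dots> \<longleftrightarrow> (\<exists>m0 ss0 r0. ss = (pre @ m0 @ post) # map (\<lambda>s. pre @ s @ post) ss0 \<and>
      r = pre @ r0 @ post \<and> step K x l m0 \<and> trace K T m0 ss0 r0)"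
    using IH by blast
  also have "\<dots> \<longleftrightarrow> (\<exists>ss0 r0. ss = map (\<lambda>s. pre @ s @ post) ss0 \<and> r = pre @ r0 @ post \<and>
      trace K (x # T) l ss0 r0)" (is "?L \<longleftrightarrow> ?R")
  proof
    assume ?L
    then obtain m0 ss0 r0 where "ss = (pre @ m0 @ post) # map (\<lambda>s. pre @ s @ post) ss0"
      "r = pre @ r0 @ post" "step K x l m0" "trace K T m0 ss0 r0" by blast
    then show ?R by (intro exI[of _ "m0 # ss0"] exI[of _ r0]) simp
  qed auto
  finally show ?case .
qed

text \<open>
  The tangle below is \<open>1/T\<close> for the mirror image \<open>T\<close>: the colours \<open>x, y, w, e\<close> of NW, SW, NE, SE
  are those of NE, NW, SE, SW of the rotated \<open>T\<close>.
\<close>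

lemma trace_inverse:
  assumes T: "tangle 2 T 2"
  shows "trace K ([Cup 2] @ shift 1 T @ [Cap 0]) [x, y] ss r \<longleftrightarrow> (\<exists>e\<in>carrier K. \<exists>w ss0. x \<in> carrier K \<and>
    r = [w, e] \<and> ss = [x, y, e, e] # map (\<lambda>s. x # s @ [e]) ss0 @ [[w, e]] \<and> trace K T [y, e] ss0 [x, w])"
proof -
  have cup: "step K (Cup 2) [x, y] m \<longleftrightarrow> (\<exists>e\<in>carrier K. m = [x, y, e, e])" for m
    using step_Cup_append[of "[x, y]" 2 K "[]" m] by simp
  have mid: "trace K (shift 1 T) [x, y, e, e] ss' m \<longleftrightarrow> (\<exists>ss0 u w. ss' = map (\<lambda>s. x # s @ [e]) ss0 \<and>
      m = [x, u, w, e] \<and> trace K T [y, e] ss0 [u, w])" for e ss' m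
  proof -
    have "\<exists>u w. r0 = [u, w]" if "trace K T [y, e] ss0 r0" for ss0 r0
      using tangle_width[OF trace_tangle[OF that]] tangle_width[OF T]
      by (auto simp: numeral_2_eq_2 length_Suc_conv)
    then show ?thesis
      using trace_shift[of "[y, e]" T 2 "[x]" 1 K "[e]" ss' m] T
      by (auto simp: numeral_2_eq_2) blast
  qed
  have cap: "step K (Cap 0) [x, u, w, e] m \<longleftrightarrow> u = x \<and> x \<in> carrier K \<and> m = [w, e]" for u w e m
    using step_Cap_append[of "[]" 0 K x u "[w, e]" m] by simp
  have "trace K (shift 1 T @ [Cap 0]) [x, y, e, e] ss' r \<longleftrightarrow> (\<exists>w ss0. x \<in> carrier K \<and> r = [w, e] \<and>
      ss' = map (\<lambda>s. x # s @ [e]) ss0 @ [[w, e]] \<and> trace K T [y, e] ss0 [x, w])"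
    (is "?L \<longleftrightarrow> ?R") for e ss'
  proof
    assume ?L
    then show ?R unfolding trace_append mid by (auto simp: cap)
  next
    assume ?R
    then obtain w ss0 where "x \<in> carrier K" "r = [w, e]"
      "ss' = map (\<lambda>s. x # s @ [e]) ss0 @ [[w, e]]" "trace K T [y, e] ss0 [x, w]" by blast
    then show ?L
      unfolding trace_append mid
      by (intro exI[of _ "map (\<lambda>s. x # s @ [e]) ss0"] exI[of _ "[[w, e]]"] exI[of _ "[x, x, w, e]"])
        (auto simp: cap)
  qed
  then show ?thesis unfolding append.simps trace.simps cup by blast
qed

lemma boundary_rel_inverse:
  assumes T: "tangle 2 T 2"
  shows "boundary_rel K ([Cup 2] @ shift 1 T @ [Cap 0]) [x, y] [w, e] \<longleftrightarrow>
    e \<in> carrier K \<and> x \<in> carrier K \<and> boundary_rel K T [y, e] [x, w]"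
  unfolding boundary_rel_def trace_inverse[OF T] by auto

text \<open>Turns the mirror image inside \<open>inverse_tangle\<close> into a continued fraction
  tangle again, so that induction reaches it.\<close>

lemma switch_continued_fraction_tangle:
  "map switch_slice (continued_fraction_tangle as) = continued_fraction_tangle (map uminus as)"
proof -
  have int: "map switch_slice (integer_tangle a) = integer_tangle (- a)" for a
    by (auto simp: integer_tangle_def)
  have "switch_slice (shift_slice d x) = shift_slice d (switch_slice x)" for d x
    by (cases x) auto
  then have inv: "map switch_slice (inverse_tangle T) = inverse_tangle (map switch_slice T)" for T
    by (simp add: inverse_tangle_def shift_def)
  show ?thesis
    by (induction as rule: continued_fraction_tangle.induct) (simp_all add: int inv)
qed

text \<open>Numerator and denominator as integers, since positions along \<psi> are integers;
  infinity is the pair (1, 0) or (-1, 0) and needs no case distinction in the recursion.\<close>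

fun continued_fraction_pair :: "int list \<Rightarrow> int \<times> int" where
  "continued_fraction_pair [] = (1, 0)"
| "continued_fraction_pair [a] = (a, 1)"
| "continued_fraction_pair (a # b # as) =
    (let (p, q) = continued_fraction_pair (b # as) in (q + a * p, p))"

lemma coprime_continued_fraction_pair:
  "continued_fraction_pair as = (p, q) \<Longrightarrow> coprime p q"
proof (induction as arbitrary: p q rule: continued_fraction_pair.induct)
  case (3 a b as)
  obtain p' q' where pq: "continued_fraction_pair (b # as) = (p', q')" by fastforce
  then have "coprime (q' + a * p') p'"
    using 3(1)[OF pq] by (metis coprime_commute coprime_iff_gcd_eq_1 gcd_add_mult add.commute mult.commute)
  then show ?case using 3 pq by auto
qed auto

lemma continued_fraction_pair_fraction:
  "continued_fraction_pair as = (p, q) \<Longrightarrow> continued_fraction as = fraction p q"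
proof (induction as arbitrary: p q rule: continued_fraction_pair.induct)
  case (3 a b as)
  obtain p' q' where pq: "continued_fraction_pair (b # as) = (p', q')" by fastforce
  have "p' \<noteq> 0 \<or> q' \<noteq> 0" using coprime_continued_fraction_pair[OF pq] by auto
  then have "reciprocal (fraction p' q') = fraction q' p'" by (auto simp: fraction_def)
  moreover have "map_option (\<lambda>x. of_int a + x) (fraction q' p') = fraction (q' + a * p') p'"
    by (auto simp: fraction_def add_divide_distrib)
  ultimately show ?case using 3(1)[OF pq] 3(2) pq by auto
qed (auto simp: fraction_def)

text \<open>Every step of the recursion swaps the components, so the sign falls on one or the other
  according to the parity of the length.\<close>

lemma continued_fraction_pair_uminus:
  "continued_fraction_pair as = (p, q) \<Longrightarrow> as \<noteq> [] \<Longrightarrow>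
    continued_fraction_pair (map uminus as) = (- p, q) \<or>
    continued_fraction_pair (map uminus as) = (p, - q)"
proof (induction as arbitrary: p q rule: continued_fraction_pair.induct)
  case (3 a b as)
  obtain p' q' where pq: "continued_fraction_pair (b # as) = (p', q')" by fastforce
  then show ?case using 3(1)[OF pq] 3(2) by auto
qed auto

definition dihedral_boundary ::
    "('a, 'm) binary_structure_scheme \<Rightarrow> int \<Rightarrow> int \<Rightarrow> 'a \<Rightarrow> 'a \<Rightarrow> 'a \<Rightarrow> 'a \<Rightarrow> bool" where
  "dihedral_boundary K p q x y z w \<longleftrightarrow>
    (\<exists>\<psi>. dihedral K \<psi> \<and> x = \<psi> 0 \<and> y = \<psi> q \<and> z = \<psi> (- p) \<and> w = \<psi> (q - p))"

text \<open>Reversing the direction of \<psi> shows that the boundary colourings depend on the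
  fraction and not on the sign chosen for the pair.\<close>

lemma dihedral_boundary_uminus: "dihedral_boundary K (- p) (- q) = dihedral_boundary K p q"
proof -
  have "dihedral_boundary K (- p) (- q) x y z w" if bd: "dihedral_boundary K p q x y z w"
    for p q x y z w
  proof -
    obtain \<psi> where \<psi>: "dihedral K \<psi>" "x = \<psi> 0" "y = \<psi> q" "z = \<psi> (- p)" "w = \<psi> (q - p)"
      using bd unfolding dihedral_boundary_def by blast
    then show ?thesis
      unfolding dihedral_boundary_def using dihedral_affine[OF \<psi>(1), of 0 "- 1"]
      by (intro exI[of _ "\<lambda>t. \<psi> (0 + - 1 * t)"]) (simp add: algebra_simps)
  qed
  from this[of p q] this[of "- p" "- q"] show ?thesis by (auto simp: fun_eq_iff)
qed

lemma fraction_eq_coprime: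
  assumes "fraction p q = fraction n q'" "coprime p q" "coprime n q'" "n > 0"
  shows "(p = n \<and> q = q') \<or> (p = - n \<and> q = - q')"
proof (cases "q = 0")
  \<comment> \<open>At infinity coprimality leaves 1 and -1 as numerators.\<close>
  case True
  then have "q' = 0" using assms(1) by (auto simp: fraction_def split: if_splits)
  then show ?thesis using True assms(2-4) by auto
next
  case False
  then have q': "q' \<noteq> 0" using assms(1) by (auto simp: fraction_def split: if_splits)
  then have "of_int p / of_int q = (of_int n / of_int q' :: rat)"
    using assms(1) False by (simp add: fraction_def)
  then have "(of_int (p * q') :: rat) = of_int (n * q)"
    using False q' by (simp add: field_simps)
  then have eq: "p * q' = n * q" by (simp only: of_int_eq_iff)
  have "p dvd n" using assms(2) eq by (metis coprime_dvd_mult_left_iff dvd_triv_left)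
  moreover have "n dvd p" using assms(3) eq by (metis coprime_dvd_mult_left_iff dvd_triv_left)
  ultimately have "\<bar>p\<bar> = \<bar>n\<bar>" by (metis zdvd_antisym_abs)
  then have "p = n \<or> p = - n" by linarith
  then show ?thesis
  proof
    assume p: "p = - n"
    then have "n * q = n * (- q')" using eq by simp
    then show ?thesis using p assms(4) by (simp only: mult_cancel_left) simp
  qed (use eq assms(4) in simp)
qed

lemma continued_fraction_boundary_rel:
  assumes K: "kei K" and "as \<noteq> []" "continued_fraction_pair as = (p, q)"
    and "x \<in> carrier K" "y \<in> carrier K"
  shows "boundary_rel K (continued_fraction_tangle as) [x, y] [z, w] \<longleftrightarrow>
    dihedral_boundary K p q x y z w"
  using assms(2-)
\<comment> \<open>Induction on the length, because the hypothesis is applied to the negated tail and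
  not to the tail itself.\<close>
proof (induction "length as" arbitrary: as p q x y z w rule: less_induct)
  case less
  show ?case
  proof (cases as rule: continued_fraction_tangle.cases)
    case 1
    then show ?thesis using less.prems by simp
  next
    case (2 a)
    then have pq: "p = a" "q = 1" using less.prems by auto
    have fwd: "boundary_rel K (integer_tangle a) [\<psi> 0, \<psi> 1] [z, w] \<longleftrightarrow> z = \<psi> (- a) \<and> w = \<psi> (1 - a)"
      if "dihedral K \<psi>" for \<psi>
      using twist_forward[OF that, of a 0 1 "[z, w]"] by simp
    obtain \<chi> where "dihedral K \<chi>" "\<chi> 0 = x" "\<chi> 1 = y"
      using dihedral_exists[OF K] less.prems by blast
    then show ?thesis
      unfolding 2 pq continued_fraction_tangle.simps dihedral_boundary_def using fwd by metis
  next
    case (3 a b bs)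
    obtain p1 q1 where pq1: "continued_fraction_pair (b # bs) = (p1, q1)" by fastforce
    have pq: "p = q1 + a * p1" "q = p1" using less.prems(2) pq1 3 by auto
    let ?T = "continued_fraction_tangle (map uminus (b # bs))"
    have T: "tangle 2 ?T 2" by (rule tangle_continued_fraction_tangle)
    have inv: "inverse_tangle (continued_fraction_tangle (b # bs)) = [Cup 2] @ shift 1 ?T @ [Cap 0]"
      unfolding inverse_tangle_def switch_continued_fraction_tangle ..
    \<comment> \<open>The tail occurs mirrored, hence with the pair (-p1, q1) up to a common sign;
      its right colours then sit at p1 and q1 + p1.\<close>
    have IH: "boundary_rel K ?T [y', w] [x', z] \<longleftrightarrow>
        (\<exists>\<psi>. dihedral K \<psi> \<and> y' = \<psi> 0 \<and> w = \<psi> q1 \<and> x' = \<psi> p1 \<and> z = \<psi> (q1 + p1))"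
      if "y' \<in> carrier K" "w \<in> carrier K" for x' y'
    proof -
      obtain p2 q2 where pq2: "continued_fraction_pair (map uminus (b # bs)) = (p2, q2)" by fastforce
      have "boundary_rel K ?T [y', w] [x', z] \<longleftrightarrow> dihedral_boundary K p2 q2 y' w x' z"
        using less.hyps[OF _ _ pq2 that] 3 by simp
      moreover have "(p2 = - p1 \<and> q2 = q1) \<or> (p2 = p1 \<and> q2 = - q1)"
        using continued_fraction_pair_uminus[OF pq1] pq2 by auto
      then have "dihedral_boundary K p2 q2 = dihedral_boundary K (- p1) q1"
        using dihedral_boundary_uminus[of K "- p1" q1] by auto
      ultimately show ?thesis by (simp add: dihedral_boundary_def)
    qed
    have rel: "boundary_rel K (continued_fraction_tangle as) [x, y] [z, w] \<longleftrightarrow>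
        (\<exists>m. boundary_rel K (integer_tangle a) [x, y] m \<and>
          boundary_rel K ([Cup 2] @ shift 1 ?T @ [Cap 0]) m [z, w])"
      unfolding 3 continued_fraction_tangle.simps inv boundary_rel_append ..
    show ?thesis
    proof
      assume "boundary_rel K (continued_fraction_tangle as) [x, y] [z, w]"
      then obtain m where m: "boundary_rel K (integer_tangle a) [x, y] m"
        "boundary_rel K ([Cup 2] @ shift 1 ?T @ [Cap 0]) m [z, w]" using rel by blast
      obtain ss where ss: "trace K (integer_tangle a) [x, y] ss m"
        using m(1) by (auto simp: boundary_rel_def)
      have int: "tangle 2 (integer_tangle a) 2"
        using tangle_continued_fraction_tangle[of "[a]"] by simp
      have "length m = 2"
        using tangle_width[OF trace_tangle[OF ss]] tangle_width[OF int] by (simp add: numeral_2_eq_2)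
      then obtain x' y' where m': "m = [x', y']" by (auto simp: numeral_2_eq_2 length_Suc_conv)
      have "set m \<subseteq> carrier K"
        using trace_carrier[OF K ss] trace_last[OF ss] less.prems by (cases ss rule: rev_cases) auto
      then have y': "y' \<in> carrier K" using m' by simp
      have "boundary_rel K ?T [y', w] [x', z]" "w \<in> carrier K"
        using m(2) unfolding m' boundary_rel_inverse[OF T] by simp_all
      then obtain \<psi> where \<psi>: "dihedral K \<psi>" "y' = \<psi> 0" "w = \<psi> q1" "x' = \<psi> p1" "z = \<psi> (q1 + p1)"
        using IH[OF y'] by blast
      have "x = \<psi> (p1 - a * p1) \<and> y = \<psi> (- a * p1)"
        using twist_backward[OF K \<psi>(1), of a x y p1 "- p1"] m(1) m' \<psi> by simp
      \<comment> \<open>New coordinates with origin at NW and reversed direction: SW, at -a * p1,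
        receives the coordinate p1 = q, and NE, at q1 + p1, receives -(q1 + a * p1) = -p.\<close>
      then show "dihedral_boundary K p q x y z w"
        unfolding dihedral_boundary_def using dihedral_affine[OF \<psi>(1), of "p1 - a * p1" "- 1"] \<psi>
        by (intro exI[of _ "\<lambda>t. \<psi> (p1 - a * p1 + - 1 * t)"]) (simp add: pq algebra_simps)
    next
      assume "dihedral_boundary K p q x y z w"
      then obtain \<chi> where \<chi>: "dihedral K \<chi>" "x = \<chi> 0" "y = \<chi> q" "z = \<chi> (- p)" "w = \<chi> (q - p)"
        unfolding dihedral_boundary_def by blast
      \<comment> \<open>The change of coordinates of the other direction is a reflection of the
        integers, hence its own inverse.\<close>
      define \<psi> where "\<psi> t = \<chi> (p1 - a * p1 + - 1 * t)" for t
      have \<psi>: "dihedral K \<psi>" unfolding \<psi>_def by (rule dihedral_affine[OF \<chi>(1)])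
      have vals: "x = \<psi> (p1 - a * p1)" "y = \<psi> (p1 - a * p1 + - p1)" "z = \<psi> (q1 + p1)" "w = \<psi> q1"
        using \<chi> by (simp_all add: \<psi>_def pq algebra_simps)
      have C: "\<psi> t \<in> carrier K" for t using \<psi> by (simp add: dihedral_def)
      have "boundary_rel K (integer_tangle a) [x, y] [\<psi> p1, \<psi> 0]"
        unfolding vals twist_forward[OF \<psi>] by simp
      moreover have "w \<in> carrier K" using C vals(4) by simp
      then have "boundary_rel K ?T [\<psi> 0, w] [\<psi> p1, z]"
        unfolding IH[OF C \<open>w \<in> carrier K\<close>] using \<psi> vals(3,4) by blast
      then have "boundary_rel K ([Cup 2] @ shift 1 ?T @ [Cap 0]) [\<psi> p1, \<psi> 0] [z, w]"
        unfolding boundary_rel_inverse[OF T] using C \<open>w \<in> carrier K\<close> by simp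
      ultimately show "boundary_rel K (continued_fraction_tangle as) [x, y] [z, w]"
        unfolding rel by blast
    qed
  qed
qed

text \<open>The twists contain no cup and are determined from the left. The free colour
  \<open>e\<close> of the cup in the rotated tail reappears at SE, so both ends of the tail are
  known and the induction hypothesis applies.\<close>

lemma boundary_determined_continued_fraction_tangle:
  assumes K: "kei K" and "as \<noteq> []"
  shows "boundary_determined K 2 (continued_fraction_tangle as)"
  using assms(2)
proof (induction "length as" arbitrary: as rule: less_induct)
  case less
  have no_cup: "\<forall>x\<in>set (integer_tangle a). \<forall>i. x \<noteq> Cup i" for a
    by (simp add: integer_tangle_def)
  show ?case
  proof (cases as rule: continued_fraction_tangle.cases)
    case (2 a)
    then show ?thesis using boundary_determined_no_Cup[OF no_cup] by simp
  next
    case (3 a b bs)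
    let ?T = "continued_fraction_tangle (map uminus (b # bs))"
    have T: "tangle 2 ?T 2" by (rule tangle_continued_fraction_tangle)
    have eq: "continued_fraction_tangle as = integer_tangle a @ [Cup 2] @ shift 1 ?T @ [Cap 0]"
      unfolding 3 continued_fraction_tangle.simps inverse_tangle_def switch_continued_fraction_tangle ..
    have IH: "boundary_determined K 2 ?T" using less.hyps[of "map uminus (b # bs)"] 3 by simp
    show ?thesis
      unfolding boundary_determined_def
    proof (intro allI impI)
      fix l r :: "'a list" and ss ss'
      assume l: "length l = 2" and "trace K (continued_fraction_tangle as) l ss r"
        "trace K (continued_fraction_tangle as) l ss' r"
      then obtain s1 s2 m s1' s2' m' where
        s: "ss = s1 @ s2" "trace K (integer_tangle a) l s1 m"
          "trace K ([Cup 2] @ shift 1 ?T @ [Cap 0]) m s2 r"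
        and s': "ss' = s1' @ s2'" "trace K (integer_tangle a) l s1' m'"
          "trace K ([Cup 2] @ shift 1 ?T @ [Cap 0]) m' s2' r"
        unfolding eq trace_append[of K "integer_tangle a"] by blast
      have u: "s1' = s1" "m' = m" using trace_unique[OF no_cup s'(2) s(2)] by simp_all
      have int: "tangle 2 (integer_tangle a) 2"
        using tangle_continued_fraction_tangle[of "[a]"] by simp
      have "length m = 2"
        using tangle_width[OF trace_tangle[OF s(2)]] tangle_width[OF int] l by simp
      then obtain x y where m: "m = [x, y]" by (auto simp: numeral_2_eq_2 length_Suc_conv)
      obtain e w ss0 where 1: "r = [w, e]" "s2 = [x, y, e, e] # map (\<lambda>s. x # s @ [e]) ss0 @ [[w, e]]"
        "trace K ?T [y, e] ss0 [x, w]"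
        using s(3) unfolding m trace_inverse[OF T] by blast
      obtain e' w' ss0' where 2: "r = [w', e']"
        "s2' = [x, y, e', e'] # map (\<lambda>s. x # s @ [e']) ss0' @ [[w', e']]"
        "trace K ?T [y, e'] ss0' [x, w']"
        using s'(3) unfolding u m trace_inverse[OF T] by blast
      have e: "e' = e" "w' = w" using 1(1) 2(1) by simp_all
      have "length [y, e] = 2" by simp
      then have "ss0 = ss0'"
        using IH 1(3) 2(3) unfolding e boundary_determined_def by blast
      then show "ss = ss'" using s(1) s'(1) u 1(2) 2(2) e by simp
    qed
  qed (use less.prems in simp)
qed

section \<open>The tangle n/q in place of [0]\<close>

lemma rational_tangle_boundary_rel:
  assumes law: "burnside_law n K" and n: "n > 0" "coprime (int n) q" "rational_tangle (int n) q T"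
    and xy: "x \<in> carrier K" "y \<in> carrier K"
  shows "boundary_rel K T [x, y] [z, w] \<longleftrightarrow> z = x \<and> w = y"
proof -
  have K: "kei K" using law by (simp add: burnside_law_def)
  obtain as where as: "as \<noteq> []" "continued_fraction as = fraction (int n) q"
    "T = continued_fraction_tangle as" using n(3) by (auto simp: rational_tangle_def)
  obtain p' q' where pq: "continued_fraction_pair as = (p', q')" by fastforce
  have "fraction p' q' = fraction (int n) q"
    using continued_fraction_pair_fraction[OF pq] as(2) by simp
  \<comment> \<open>The list determines the fraction in lowest terms, but its pair may carry both
    signs reversed.\<close>
  then have cases: "(p' = int n \<and> q' = q) \<or> (p' = - int n \<and> q' = - q)"
    using fraction_eq_coprime coprime_continued_fraction_pair[OF pq] n by simp
  then have "coprime (int n) q'" using n(2) by auto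
  then obtain \<psi>0 where \<psi>0: "dihedral K \<psi>0" "\<psi>0 0 = x" "\<psi>0 q' = y"
    using dihedral_with_values[OF law _ xy] by blast
  have "\<exists>k. - p' = 0 + k * int n \<and> q' - p' = q' + k * int n"
    using cases by (elim disjE) (rule exI[of _ "- 1"], simp, rule exI[of _ 1], simp)
  then have per: "\<psi> (- p') = \<psi> 0 \<and> \<psi> (q' - p') = \<psi> q'" if "dihedral K \<psi>" for \<psi>
    using dihedral_periodic[OF law that] by metis
  show ?thesis
    unfolding as(3) continued_fraction_boundary_rel[OF K as(1) pq xy] dihedral_boundary_def
    using per \<psi>0 by metis
qed

lemma rational_tangle_exchangeable:
  assumes law: "burnside_law n K" and n: "n > 0" "coprime (int n) q" "rational_tangle (int n) q T"
    and i: "i + 2 \<le> m"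
  shows "exchangeable K m (shift i T) []"
proof (rule exchangeableI)
  have K: "kei K" using law by (simp add: burnside_law_def)
  obtain as where as: "as \<noteq> []" "T = continued_fraction_tangle as"
    using n(3) by (auto simp: rational_tangle_def)
  have T: "tangle 2 T 2" unfolding as(2) by (rule tangle_continued_fraction_tangle)
  have det: "boundary_determined K 2 T"
    unfolding as(2) by (rule boundary_determined_continued_fraction_tangle[OF K as(1)])
  show "boundary_determined K m []" by (rule boundary_determined_short)
  have split: "\<exists>pre x y post. l = pre @ [x, y] @ post \<and> length pre = i" if l: "length l = m" for l :: "'a list"
  proof -
    obtain pre mid post where *: "l = pre @ mid @ post" "length pre = i" "length mid = 2"
      using list_split[of i 2 l] i l by blast
    then obtain x y where "mid = [x, y]" by (auto simp: numeral_2_eq_2 length_Suc_conv)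
    then show ?thesis using * by blast
  qed
  \<comment> \<open>Strands outside the ball are carried along unchanged in \<open>pre\<close> and
    \<open>post\<close>.\<close>
  have tr: "trace K (shift i T) (pre @ [x, y] @ post) ss r \<longleftrightarrow>
      (\<exists>ss0 z w. ss = map (\<lambda>s. pre @ s @ post) ss0 \<and> r = pre @ [z, w] @ post \<and> trace K T [x, y] ss0 [z, w])"
    if "length pre = i" for pre x y post ss r
  proof -
    have "\<exists>z w. r0 = [z, w]" if "trace K T [x, y] ss0 r0" for ss0 r0
      using tangle_width[OF trace_tangle[OF that]] tangle_width[OF T]
      by (auto simp: numeral_2_eq_2 length_Suc_conv)
    moreover have "tangle (length [x, y]) T 2" using T by (simp add: numeral_2_eq_2)
    ultimately show ?thesis unfolding trace_shift[OF \<open>tangle (length [x, y]) T 2\<close> that] by blast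
  qed
  show "boundary_determined K m (shift i T)"
    unfolding boundary_determined_def
  proof (intro allI impI)
    fix l r ss ss' assume l: "length l = m" and t: "trace K (shift i T) l ss r" "trace K (shift i T) l ss' r"
    obtain pre x y post where l': "l = pre @ [x, y] @ post" "length pre = i" using split[OF l] by blast
    obtain ss0 z w where 1: "ss = map (\<lambda>s. pre @ s @ post) ss0" "r = pre @ [z, w] @ post"
      "trace K T [x, y] ss0 [z, w]" using t(1) unfolding l'(1) tr[OF l'(2)] by blast
    obtain ss0' z' w' where 2: "ss' = map (\<lambda>s. pre @ s @ post) ss0'" "r = pre @ [z', w'] @ post"
      "trace K T [x, y] ss0' [z', w']" using t(2) unfolding l'(1) tr[OF l'(2)] by blast
    have "z' = z" "w' = w" using 1(2) 2(2) by simp_all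
    moreover have "length [x, y] = 2" by simp
    ultimately have "ss0 = ss0'" using det 1(3) 2(3) unfolding boundary_determined_def by blast
    then show "ss = ss'" using 1(1) 2(1) by simp
  qed
  fix l r :: "'a list" assume l: "length l = m" "set l \<subseteq> carrier K"
  obtain pre x y post where l': "l = pre @ [x, y] @ post" "length pre = i" using split[OF l(1)] by blast
  have xy: "x \<in> carrier K" "y \<in> carrier K" using l(2) l' by simp_all
  have "boundary_rel K (shift i T) l r \<longleftrightarrow> (\<exists>z w. r = pre @ [z, w] @ post \<and> boundary_rel K T [x, y] [z, w])"
    unfolding boundary_rel_def l'(1) tr[OF l'(2)] by blast
  then show "boundary_rel K (shift i T) l r = boundary_rel K [] l r"
    unfolding rational_tangle_boundary_rel[OF law n xy] using l'(1) by simp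
qed

lemma tangle_shift:
  assumes "tangle m T n"
  shows "tangle (d + m) (shift d T) (d + n)"
  using assms
proof (induction T arbitrary: m)
  case (Cons x T)
  have "slice_fits (shift_slice d x) (d + m) \<and> slice_width (shift_slice d x) (d + m) = d + slice_width x m"
    using Cons.prems by (cases x) auto
  then show ?case using Cons by (simp add: shift_def)
qed (simp add: shift_def)

text \<open>The further strands run below the tangle; together with \<open>tangle_shift\<close>,
  which puts strands above it, this places a 2-tangle anywhere among \<open>m\<close>
  strands.\<close>

lemma tangle_extend:
  assumes "tangle k T k'"
  shows "tangle (k + e) T (k' + e)"
  using assms
proof (induction T arbitrary: k)
  case (Cons x T)
  have "slice_fits x (k + e) \<and> slice_width x (k + e) = slice_width x k + e"
    using Cons.prems by (cases x) auto
  then show ?case using Cons by simp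
qed simp

lemma replaces_rational_burnside_kei:
  assumes n: "n > 0" "coprime (int n) q" "rational_tangle (int n) q T"
    and rep: "replaces (integer_tangle 0) T E E' \<or> replaces T (integer_tangle 0) E E'"
  shows "burnside_kei n E \<cong>\<^sub>K burnside_kei n E'"
proof -
  have T: "tangle 2 T 2"
    using n(3) tangle_continued_fraction_tangle by (auto simp: rational_tangle_def)
  have zero: "shift i (integer_tangle 0) = []" for i by (simp add: shift_def integer_tangle_def)
  obtain A B i m where A: "tangle 0 A m" and i: "i + 2 \<le> m" and B: "tangle m B 0"
    and E: "(E = A @ [] @ B \<and> E' = A @ shift i T @ B) \<or> (E = A @ shift i T @ B \<and> E' = A @ [] @ B)"
    using rep unfolding replaces_def zero by blast
  have "tangle m (shift i T) m"
    using tangle_extend[OF tangle_shift[OF T, of i], of "m - (i + 2)"]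
    unfolding le_add_diff_inverse[OF i] .
  then have D: "link_diagram (A @ [] @ B)" "link_diagram (A @ shift i T @ B)"
    using A B by (auto simp: link_diagram_def tangle_append)
  have ex: "exchangeable K m (shift i T) []" if "burnside_law n K"
    for K :: "(nat \<times> nat) set kei_term set set set binary_structure"
    by (rule rational_tangle_exchangeable[OF that n i])
  have "burnside_kei n (A @ shift i T @ B) \<cong>\<^sub>K burnside_kei n (A @ [] @ B)"
    by (rule burnside_kei_exchange[OF A D(2,1) ex])
  moreover have "burnside_kei n (A @ [] @ B) \<cong>\<^sub>K burnside_kei n (A @ shift i T @ B)"
    by (rule burnside_kei_exchange[OF A D exchangeable_sym[OF ex]])
  ultimately show ?thesis using E by metis
qed

lemma rational_move_burnside_kei:
  assumes "n > 0" "coprime (int n) q" "rational_move (int n) q D D'"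
  shows "burnside_kei n D \<cong>\<^sub>K burnside_kei n D'"
proof -
  obtain E E' T where "isotopic D E" "isotopic E' D'" and T: "rational_tangle (int n) q T"
    "replaces (integer_tangle 0) T E E' \<or> replaces T (integer_tangle 0) E E'"
    using assms(3) unfolding rational_move_def by blast
  then have "burnside_kei n D \<cong>\<^sub>K burnside_kei n E" "burnside_kei n E' \<cong>\<^sub>K burnside_kei n D'"
    by (simp_all add: isotopic_burnside_kei)
  then show ?thesis
    using replaces_rational_burnside_kei[OF assms(1,2) T] kei_isomorphic_trans by blast
qed

theorem lemma3p3:
  fixes n :: nat and D D' :: diagram
  assumes "n > 0" and "link_diagram D" and "link_diagram D'"
  shows "(n_move n D D' \<longrightarrow> burnside_kei n D \<cong>\<^sub>K burnside_kei n D') \<and>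
    (\<forall>q::int. coprime (int n) q \<longrightarrow> rational_move (int n) q D D' \<longrightarrow>
       burnside_kei n D \<cong>\<^sub>K burnside_kei n D')"
  using rational_move_burnside_kei[OF assms(1)] rational_move_burnside_kei[OF assms(1), of 1]
  by (simp add: n_move_def)

end
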